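(* Let $(A,\circ_\lambda)$ be a commutative associative conformal algebra and let $(A[[\hbar]],\circ^\hbar_\lambda)$ be a conformal formal deformation of $(A,\circ_\lambda)$, with $a\circ^\hbar_\lambda b=a\circ_\lambda b+\sum_{n\ge1}\hbar^n\{a_\lambda b\}_{\mu_n}$ for $a,b\in A$. Define $$[a_\lambda b]=\{a_\lambda b\}_{\mu_1}-\{b_{-\lambda-\partial}a\}_{\mu_1},\qquad a,b\in A.$$ Then $(A,\circ_\lambda,[\cdot_\lambda\cdot])$ is a Poisson conformal algebra (called the semi-classical limit of $(A[[\hbar]],\circ^\hbar_\lambda)$).
   Context: All vector spaces are over $\mathbb{C}$. A conformal algebra is a $\mathbb{C}[\partial]$-module $A$ with a $\mathbb{C}$-bilinear map $A\times A\to A[\lambda]$, $(a,b)\mapsto a_\lambda b$, such that $(\partial a)_\lambda b=-\lambda\, a_\lambda b$ and $a_\lambda(\partial b)=(\partial+\lambda)(a_\lambda b)$. In $b_{-\lambda-\partial}a$ the variable is replaced by $-\lambda-\partial$ with $\partial$ moved to the left, acting on the coefficients. An associative conformal algebra is a conformal algebra $(A,\circ_\lambda)$ with $a\circ_\lambda(b\circ_\mu c)=(a\circ_\lambda b)\circ_{\lambda+\mu}c$; it is commutative if $a\circ_\lambda b=b\circ_{-\lambda-\partial}a$. A Lie conformal algebra is a conformal algebra $(A,[\cdot_\lambda\cdot])$ with $[a_\lambda b]=-[b_{-\lambda-\partial}a]$ and $[a_\lambda[b_\mu c]]=[[a_\lambda b]_{\lambda+\mu}c]+[b_\mu[a_\lambda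 c]]$. A Poisson conformal algebra is a $\mathbb{C}[\partial]$-module with a commutative associative conformal structure $\circ_\lambda$ and a Lie conformal structure $[\cdot_\lambda\cdot]$ satisfying $[a_\lambda(b\circ_\mu c)]=[a_\lambda b]\circ_{\lambda+\mu}c+b\circ_\mu[a_\lambda c]$. An $\hbar$-adic associative conformal algebra is a $\mathbb{C}[[\hbar]]$-module $A[[\hbar]]$, with $A$ a vector space, equipped with the $\hbar$-adic topology, a $\mathbb{C}[\partial]$-module structure and a continuous $\mathbb{C}[[\hbar]]$-bilinear $\lambda$-operation $\circ^\hbar_\lambda:A[[\hbar]]\times A[[\hbar]]\to A[[\hbar]][[\lambda]]$ such that for every $n\in\mathbb{N}$ the quotient $A[[\hbar]]/\hbar^nA[[\hbar]]$ with the induced $\lambda$-operation $(a+\hbar^nA[[\hbar]])\,\bar\circ^\hbar_\lambda\,(b+\hbar^nA[[\hbar]])=a\circ^\hbar_\lambda b+\hbar^nA[[\hbar]]$ is an associative conformal algebra over $\mathbb{C}[[\hbar]]$. A conformal formal deformation of a commutative associative conformal algebra $(A,\circ_\lambda)$ is a continuous $\mathbb{C}[[\hbar]]$-bilinear $\lambda$-operation $\circ^\hbar_\lambda:A[[\hbar]]\times A[[\hbar]]\to A[[\hbar]][[\lambda]]$ making $A[[\hbar]]$ (with $\partial$ extended $\mathbb{C}[[\hbar]]$-linearly and continuously from $A$) an $\hbar$-adic associative conformal algebra, such that for $a,b\in A$ $$a\circ^\hbar_\lambda b=\sum_{n\ge0}\hbar^n\{a_\lambda b\}_{\mu_n}=a\circ_\lambda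 b+\sum_{n\ge1}\hbar^n\{a_\lambda b\}_{\mu_n},$$ where $\mu_n:A\times A\to A[\lambda]$, $(a,b)\mapsto\{a_\lambda b\}_{\mu_n}$, are $\mathbb{C}$-bilinear maps for $n\ge0$ and $\mu_0$ is the given operation $\circ_\lambda$. *)

theory Defs
  imports
    "HOL-Analysis.Analysis"
    "HOL-Computational_Algebra.Formal_Power_Series"
    "HOL-Algebra.Module"
    "HOL-Algebra.UnivPoly"
    "HOL-Algebra.Algebraic_Closure_Type"
begin

section \<open>Conformal algebras over a commutative ring\<close>

text \<open>
  A \<open>\<lambda>\<close>-operation on \<open>M\<close> is given by its coefficients: \<open>p a b i\<close> is the coefficient of
  \<open>\<lambda>\<^sup>i\<close> in the product of \<open>a\<close> and \<open>b\<close>.  Elements of \<open>M[[\<lambda>]]\<close> are thus functions \<open>nat \<Rightarrow> 'm\<close>,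
  and those in \<^const>\<open>up\<close> \<open>M\<close> are the polynomials \<open>M[\<lambda>]\<close>.
\<close>

type_synonym 'm lambda_op = "'m \<Rightarrow> 'm \<Rightarrow> nat \<Rightarrow> 'm"

definition bilinear_lambda_op ::
    "('r, 'k) ring_scheme \<Rightarrow> ('r, 'm, 'n) module_scheme \<Rightarrow> 'm lambda_op \<Rightarrow> bool" where
  "bilinear_lambda_op R M p \<longleftrightarrow>
     (\<forall>a\<in>carrier M. \<forall>b\<in>carrier M. \<forall>i. p a b i \<in> carrier M) \<and>
     (\<forall>a\<in>carrier M. \<forall>a'\<in>carrier M. \<forall>b\<in>carrier M. \<forall>i.
        p (a \<oplus>\<^bsub>M\<^esub> a') b i = p a b i \<oplus>\<^bsub>M\<^esub> p a' b i) \<and>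
     (\<forall>a\<in>carrier M. \<forall>b\<in>carrier M. \<forall>b'\<in>carrier M. \<forall>i.
        p a (b \<oplus>\<^bsub>M\<^esub> b') i = p a b i \<oplus>\<^bsub>M\<^esub> p a b' i) \<and>
     (\<forall>r\<in>carrier R. \<forall>a\<in>carrier M. \<forall>b\<in>carrier M. \<forall>i.
        p (r \<odot>\<^bsub>M\<^esub> a) b i = r \<odot>\<^bsub>M\<^esub> p a b i \<and> p a (r \<odot>\<^bsub>M\<^esub> b) i = r \<odot>\<^bsub>M\<^esub> p a b i)"

definition polynomial_lambda_op :: "('r, 'm, 'n) module_scheme \<Rightarrow> 'm lambda_op \<Rightarrow> bool" where
  "polynomial_lambda_op M p \<longleftrightarrow> (\<forall>a\<in>carrier M. \<forall>b\<in>carrier M. p a b \<in> up M)"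

text \<open>
  \<open>lambda_swap M D p a b i\<close> is the coefficient of \<open>\<lambda>\<^sup>i\<close> in \<open>p\<close> applied to \<open>b, a\<close> (in this order) at
  \<open>-\<lambda>-\<partial>\<close>, that is, in \<open>\<Sum>m. (-\<lambda>-\<partial>)\<^sup>m (p b a m)\<close> with
  \<open>(-\<lambda>-\<partial>)\<^sup>m = \<Sum>i\<le>m. (-1)\<^sup>m (m choose i) \<lambda>\<^sup>i \<partial>\<^sup>m\<^sup>-\<^sup>i\<close>.  Vanishing coefficients are left out of
  the index set because \<^const>\<open>finsum\<close> needs a finite one.
\<close>

definition lambda_swap ::
    "('r, 'm, 'n) module_scheme \<Rightarrow> ('m \<Rightarrow> 'm) \<Rightarrow> 'm lambda_op \<Rightarrow> 'm lambda_op" where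
  "lambda_swap M D p a b i =
     (\<Oplus>\<^bsub>M\<^esub>m\<in>{m. i \<le> m \<and> p b a m \<noteq> \<zero>\<^bsub>M\<^esub>}.
        [((- 1) ^ m * int (m choose i))] \<cdot>\<^bsub>M\<^esub> ((D ^^ (m - i)) (p b a m)))"

text \<open>
  Let \<open>F k m\<close> be the coefficient of \<open>\<lambda>\<^sup>k \<nu>\<^sup>m\<close>.  Then \<open>subst_lambda_plus_mu M F i j\<close> is the
  coefficient of \<open>\<lambda>\<^sup>i \<mu>\<^sup>j\<close> after substituting \<open>\<nu> = \<lambda> + \<mu>\<close>: the monomial \<open>\<lambda>\<^sup>k (\<lambda> + \<mu>)\<^sup>m\<close> contributes
  iff \<open>k \<le> i\<close> and \<open>m = i + j - k\<close>, with factor \<open>m choose j\<close>.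
\<close>

definition subst_lambda_plus_mu ::
    "('r, 'm, 'n) module_scheme \<Rightarrow> (nat \<Rightarrow> nat \<Rightarrow> 'm) \<Rightarrow> nat \<Rightarrow> nat \<Rightarrow> 'm" where
  "subst_lambda_plus_mu M F i j =
     (\<Oplus>\<^bsub>M\<^esub>k\<in>{..i}. [((i + j - k) choose j)] \<cdot>\<^bsub>M\<^esub> F k (i + j - k))"

text \<open>An \<open>R[\<partial>]\<close>-module is an \<open>R\<close>-module with an \<open>R\<close>-linear endomorphism \<open>D\<close>, the action of \<open>\<partial>\<close>.\<close>

locale differential_module = Module.module R M
  for R :: "('r, 'k) ring_scheme" (structure) and M :: "('r, 'm, 'n) module_scheme" (structure) +
  fixes D :: "'m \<Rightarrow> 'm"
  assumes D_closed: "x \<in> carrier M \<Longrightarrow> D x \<in> carrier M"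
    and D_add: "x \<in> carrier M \<Longrightarrow> y \<in> carrier M \<Longrightarrow> D (x \<oplus>\<^bsub>M\<^esub> y) = D x \<oplus>\<^bsub>M\<^esub> D y"
    and D_smult: "r \<in> carrier R \<Longrightarrow> x \<in> carrier M \<Longrightarrow> D (r \<odot>\<^bsub>M\<^esub> x) = r \<odot>\<^bsub>M\<^esub> D x"

locale conformal_algebra = differential_module R M D
  for R :: "('r, 'k) ring_scheme" (structure) and M :: "('r, 'm, 'n) module_scheme" (structure)
    and D :: "'m \<Rightarrow> 'm" +
  fixes p :: "'m lambda_op"
  assumes bilinear: "bilinear_lambda_op R M p"
    and polynomial: "polynomial_lambda_op M p"
    and sesquilinear_left: "a \<in> carrier M \<Longrightarrow> b \<in> carrier M \<Longrightarrow>
      p (D a) b i = (case i of 0 \<Rightarrow> \<zero>\<^bsub>M\<^esub> | Suc k \<Rightarrow> \<ominus>\<^bsub>M\<^esub> p a b k)"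
    and sesquilinear_right: "a \<in> carrier M \<Longrightarrow> b \<in> carrier M \<Longrightarrow>
      p a (D b) i = D (p a b i) \<oplus>\<^bsub>M\<^esub> (case i of 0 \<Rightarrow> \<zero>\<^bsub>M\<^esub> | Suc k \<Rightarrow> p a b k)"

text \<open>In the following identities \<open>i\<close> is the exponent of \<open>\<lambda>\<close> and \<open>j\<close> the exponent of \<open>\<mu>\<close>.\<close>

locale assoc_conformal_algebra = conformal_algebra R M D p
  for R :: "('r, 'k) ring_scheme" (structure) and M :: "('r, 'm, 'n) module_scheme" (structure)
    and D :: "'m \<Rightarrow> 'm" and p :: "'m lambda_op" +
  assumes associative: "a \<in> carrier M \<Longrightarrow> b \<in> carrier M \<Longrightarrow> c \<in> carrier M \<Longrightarrow>
      p a (p b c j) i = subst_lambda_plus_mu M (\<lambda>k m. p (p a b k) c m) i j"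

locale comm_assoc_conformal_algebra = assoc_conformal_algebra R M D p
  for R :: "('r, 'k) ring_scheme" (structure) and M :: "('r, 'm, 'n) module_scheme" (structure)
    and D :: "'m \<Rightarrow> 'm" and p :: "'m lambda_op" +
  assumes commutative: "a \<in> carrier M \<Longrightarrow> b \<in> carrier M \<Longrightarrow> p a b i = lambda_swap M D p a b i"

locale Lie_conformal_algebra = conformal_algebra R M D br
  for R :: "('r, 'k) ring_scheme" (structure) and M :: "('r, 'm, 'n) module_scheme" (structure)
    and D :: "'m \<Rightarrow> 'm" and br :: "'m lambda_op" +
  assumes skew_symmetric: "a \<in> carrier M \<Longrightarrow> b \<in> carrier M \<Longrightarrow>
      br a b i = \<ominus>\<^bsub>M\<^esub> lambda_swap M D br a b i"
    and Jacobi: "a \<in> carrier M \<Longrightarrow> b \<in> carrier M \<Longrightarrow> c \<in> carrier M \<Longrightarrow>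
      br a (br b c j) i =
        subst_lambda_plus_mu M (\<lambda>k m. br (br a b k) c m) i j \<oplus>\<^bsub>M\<^esub> br b (br a c i) j"

locale Poisson_conformal_algebra =
  comm_assoc_conformal_algebra R M D p + Lie: Lie_conformal_algebra R M D br
  for R :: "('r, 'k) ring_scheme" (structure) and M :: "('r, 'm, 'n) module_scheme" (structure)
    and D :: "'m \<Rightarrow> 'm" and p br :: "'m lambda_op" +
  assumes Leibniz: "a \<in> carrier M \<Longrightarrow> b \<in> carrier M \<Longrightarrow> c \<in> carrier M \<Longrightarrow>
      br a (p b c j) i =
        subst_lambda_plus_mu M (\<lambda>k m. p (br a b k) c m) i j \<oplus>\<^bsub>M\<^esub> p b (br a c i) j"

section \<open>Vector spaces, formal power series and quotients as modules\<close>

abbreviation complex_ring :: "complex ring" where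
  "complex_ring \<equiv> ring_of_type_algebra"

abbreviation complex_fps_ring :: "complex fps ring" where
  "complex_fps_ring \<equiv> ring_of_type_algebra"

text \<open>The fields \<open>mult\<close> and \<open>one\<close> of a module record play no role in \<^locale>\<open>module\<close>.\<close>

definition type_module :: "('r \<Rightarrow> 'm \<Rightarrow> 'm) \<Rightarrow> ('r, 'm::ab_group_add) module" where
  "type_module scl =
     \<lparr>carrier = UNIV, monoid.mult = undefined, one = undefined,
      ring.zero = 0, add = (+), smult = scl\<rparr>"

definition fps_scale :: "('r::zero \<Rightarrow> 'a::ab_group_add \<Rightarrow> 'a) \<Rightarrow> 'r fps \<Rightarrow> 'a fps \<Rightarrow> 'a fps" where
  "fps_scale scl r x = Abs_fps (\<lambda>n. \<Sum>i\<le>n. scl (fps_nth r i) (fps_nth x (n - i)))"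

text \<open>The module \<open>A[[\<hbar>]]\<close> over the formal power series ring, and its submodule \<open>\<hbar>\<^sup>n A[[\<hbar>]]\<close>.\<close>

definition hbar_module ::
    "(complex \<Rightarrow> 'a \<Rightarrow> 'a) \<Rightarrow> (complex fps, 'a::ab_group_add fps) module" where
  "hbar_module scl = type_module (fps_scale scl)"

definition hbar_power_submodule :: "(complex \<Rightarrow> 'a \<Rightarrow> 'a) \<Rightarrow> nat \<Rightarrow> 'a::ab_group_add fps set" where
  "hbar_power_submodule scl n = range (\<lambda>x. fps_scale scl (fps_X ^ n) x)"

text \<open>
  Maps on a quotient are unions over representatives of the cosets of the values.  If an operation is
  not compatible with the submodule, such a union is not a coset, so the closure conditions on the
  quotient also say that the induced operation is well defined.
\<close>

definition quotient_module ::
    "('r, 'm, 'n) module_scheme \<Rightarrow> 'm set \<Rightarrow> ('r, 'm set) module" where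
  "quotient_module M H =
     \<lparr>carrier = a_rcosets\<^bsub>M\<^esub> H, monoid.mult = undefined, one = undefined,
      ring.zero = H, add = set_add M, smult = (\<lambda>r U. \<Union>x\<in>U. H +>\<^bsub>M\<^esub> (r \<odot>\<^bsub>M\<^esub> x))\<rparr>"

definition quotient_map ::
    "('r, 'm, 'n) module_scheme \<Rightarrow> 'm set \<Rightarrow> ('m \<Rightarrow> 'm) \<Rightarrow> 'm set \<Rightarrow> 'm set" where
  "quotient_map M H f U = (\<Union>x\<in>U. H +>\<^bsub>M\<^esub> f x)"

definition quotient_lambda_op ::
    "('r, 'm, 'n) module_scheme \<Rightarrow> 'm set \<Rightarrow> 'm lambda_op \<Rightarrow> 'm set lambda_op" where
  "quotient_lambda_op M H p U V i = (\<Union>x\<in>U. \<Union>y\<in>V. H +>\<^bsub>M\<^esub> p x y i)"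

section \<open>Conformal formal deformations\<close>

text \<open>
  The library topology on \<^typ>\<open>'a fps\<close> is the \<open>\<hbar>\<close>-adic one; on \<^typ>\<open>nat \<Rightarrow> 'a fps\<close>, which
  represents \<open>A[[\<hbar>]][[\<lambda>]]\<close>, it is the topology of coefficientwise \<open>\<hbar>\<close>-adic convergence.
\<close>

locale hbar_adic_assoc_conformal_algebra =
  fixes scl :: "complex \<Rightarrow> 'a::ab_group_add \<Rightarrow> 'a"
    and Dh :: "'a fps \<Rightarrow> 'a fps"
    and ph :: "'a fps lambda_op"
  assumes vector_space: "Vector_Spaces.vector_space scl"
    and differential_module: "differential_module complex_fps_ring (hbar_module scl) Dh"
    and bilinear: "bilinear_lambda_op complex_fps_ring (hbar_module scl) ph"
    and continuous: "continuous_on UNIV (\<lambda>(x, y). ph x y)"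
    and quotient: "\<And>n. assoc_conformal_algebra complex_fps_ring
      (quotient_module (hbar_module scl) (hbar_power_submodule scl n))
      (quotient_map (hbar_module scl) (hbar_power_submodule scl n) Dh)
      (quotient_lambda_op (hbar_module scl) (hbar_power_submodule scl n) ph)"

text \<open>
  \<open>fps_map D\<close> is the only \<open>\<hbar>\<close>-adically continuous extension of \<open>D\<close> from \<open>A\<close> to \<open>A[[\<hbar>]]\<close> that is
  linear over formal power series in \<open>\<hbar>\<close>.
\<close>

definition fps_map :: "('a \<Rightarrow> 'a) \<Rightarrow> 'a fps \<Rightarrow> 'a fps" where
  "fps_map D x = Abs_fps (\<lambda>n. D (fps_nth x n))"

text \<open>
  The vector space \<open>A\<close> sits in \<open>A[[\<hbar>]]\<close> via \<^const>\<open>fps_const\<close>, and \<open>\<mu> n a b i\<close> is the coefficient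
  of \<open>\<hbar>\<^sup>n \<lambda>\<^sup>i\<close> in the deformed product of \<open>a, b \<in> A\<close>.
\<close>

locale conformal_deformation =
  comm_assoc_conformal_algebra complex_ring "type_module scl" D p +
  deformed: hbar_adic_assoc_conformal_algebra scl "fps_map D" ph
  for scl :: "complex \<Rightarrow> 'a::ab_group_add \<Rightarrow> 'a"
    and D :: "'a \<Rightarrow> 'a"
    and p :: "'a lambda_op"
    and ph :: "'a fps lambda_op" +
  fixes \<mu> :: "nat \<Rightarrow> 'a lambda_op"
  assumes \<mu>_bilinear: "bilinear_lambda_op complex_ring (type_module scl) (\<mu> n)"
    and \<mu>_polynomial: "polynomial_lambda_op (type_module scl) (\<mu> n)"
    and \<mu>_0: "\<mu> 0 = p"
    and expansion: "ph (fps_const a) (fps_const b) i = Abs_fps (\<lambda>n. \<mu> n a b i)"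

definition semiclassical_bracket ::
    "(complex \<Rightarrow> 'a \<Rightarrow> 'a) \<Rightarrow> ('a \<Rightarrow> 'a) \<Rightarrow> (nat \<Rightarrow> 'a lambda_op) \<Rightarrow> 'a::ab_group_add lambda_op" where
  "semiclassical_bracket scl D \<mu> a b i =
     \<mu> 1 a b i - lambda_swap (type_module scl) D (\<mu> 1) a b i"

end

theory Submission
  imports Defs
begin

text \<open>
  The idea is the classical one: the commutator of an associative product is a Lie bracket and acts
  on the product by derivations; when the product is commutative modulo \<open>\<hbar>\<close>, the commutator is
  divisible by \<open>\<hbar>\<close>, and the lowest nontrivial coefficients of the Leibniz rule and of the Jacobi
  identity are statements about \<open>\<circ>\<^sub>\<lambda>\<close> and the semi-classical bracket alone.

  \<^item> Associativity of the deformed product passes from all quotients modulo \<open>\<hbar>\<^sup>n\<close> to the full module,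
    and its coefficient of \<open>\<hbar>\<^sup>k\<close> says that the family of pairs \<open>(\<mu>\<^sub>m, \<mu>\<^sub>k\<^sub>-\<^sub>m)\<close> with \<open>m \<le> k\<close> is associative in
    total: the sum over \<open>m\<close> of \<open>a\<^sub>\<lambda>(b\<^sub>\<mu> c)\<close>, with \<open>\<mu>\<^sub>m\<close> as outer and \<open>\<mu>\<^sub>k\<^sub>-\<^sub>m\<close> as inner product, equals the
    same sum for \<open>(a\<^sub>\<lambda> b)\<^sub>\<lambda>\<^sub>+\<^sub>\<mu> c\<close> (lemma \<open>\<mu>poly_associative\<close>).
  \<^item> For any family of pairs of sesquilinear operations that is associative in total, the commutators
    satisfy the Leibniz rule and the Jacobi identity in total (lemmas \<open>commutator_Leibniz\<close> and
    \<open>commutator_Jacobi\<close>).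
  \<^item> The commutator of \<open>\<mu>\<^sub>0\<close> vanishes because \<open>\<circ>\<^sub>\<lambda>\<close> is commutative.  Hence each of the sums
    in the Leibniz rule for \<open>k = 1\<close> and in the Jacobi identity for \<open>k = 2\<close> has at most one nonzero summand,
    and what remains are the two axioms to be shown.

  The second point is a computation with the substitutions \<open>\<lambda> \<mapsto> -\<lambda>-\<partial>\<close>.  To avoid binomial sums,
  a \<open>\<lambda>\<close>-product is treated as a polynomial that can be evaluated at any operator \<open>S\<close> commuting with \<open>\<partial>\<close>,
  giving products \<open>a\<^sub>S b\<close>.  Commuting \<open>S\<close> and \<open>T\<close> have a third companion \<open>N = -S-T-\<partial>\<close>, and \<open>S\<close>, \<open>T\<close>, \<open>N\<close>
  play symmetric roles: one variable is attached to each of three factors, and permuting the factors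
  permutes the variables.  With \<open>U\<^sub>S\<^sub>T(a,b,c) = a\<^sub>S(b\<^sub>T c) = (a\<^sub>S b)\<^sub>S\<^sub>+\<^sub>T c\<close>, the commutator of
  \<open>a\<close> with that of \<open>b\<close> and \<open>c\<close> is
  \<open>U\<^sub>S\<^sub>T(a,b,c) - U\<^sub>S\<^sub>N(a,c,b) - U\<^sub>T\<^sub>N(b,c,a) + U\<^sub>N\<^sub>T(c,b,a)\<close>, exactly as in an associative algebra, and the
  identities become cancellations of such terms.  Coefficients are compared only at the end.
\<close>

section \<open>Evaluating polynomials at operators\<close>

text \<open>
  \<open>eval_at G S f\<close> is \<open>\<Sum>m. S\<^sup>m (G f\<^sub>m)\<close>: the coefficients are transported by \<open>G\<close> into an abelian group on
  which the operator \<open>S\<close> takes the place of the variable.  The Horner form makes polynomial induction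
  immediate.
\<close>

definition eval_at :: "('a::zero \<Rightarrow> 'v) \<Rightarrow> ('v \<Rightarrow> 'v) \<Rightarrow> 'a poly \<Rightarrow> 'v::ab_group_add" where
  "eval_at G S f = fold_coeffs (\<lambda>a s. G a + S s) f 0"

lemma eval_at_0 [simp]: "eval_at G S 0 = 0"
  by (simp add: eval_at_def)

lemma eval_at_pCons:
  assumes "Modules.additive G" "Modules.additive S"
  shows "eval_at G S (pCons a f) = G a + S (eval_at G S f)"
proof (cases "a = 0 \<and> f = 0")
  case True
  then show ?thesis
    by (simp add: eval_at_def additive.zero[OF assms(1)] additive.zero[OF assms(2)])
next
  case False
  then show ?thesis by (cases "f = 0") (auto simp: eval_at_def)
qed

lemma eval_at_const:
  assumes "Modules.additive G" "Modules.additive S"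
  shows "eval_at G S [:a:] = G a"
  using eval_at_pCons[OF assms, of a 0] by (simp add: additive.zero[OF assms(2)])

lemma eval_at_add:
  assumes "Modules.additive G" "Modules.additive S"
  shows "eval_at G S (f + g) = eval_at G S f + eval_at G S g"
proof (induction f g rule: poly_induct2)
  case 0
  then show ?case by simp
next
  case (pCons a f b g)
  then show ?case
    by (simp add: eval_at_pCons[OF assms] additive.add[OF assms(1)] additive.add[OF assms(2)])
qed

lemma additive_eval_at:
  assumes "Modules.additive G" "Modules.additive S"
  shows "Modules.additive (eval_at G S)"
  by unfold_locales (rule eval_at_add[OF assms])

text \<open>
  Evaluation is the only additive map that is \<open>G\<close> on constants and turns multiplication by the variable
  into \<open>S\<close>; hence it is compatible with every additive map that intertwines two operators.
\<close>

lemma eval_at_natural: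
  assumes "Modules.additive G" "Modules.additive S" "Modules.additive S'" "Modules.additive h"
    and "\<And>v. h (S v) = S' (h v)"
  shows "h (eval_at G S f) = eval_at (\<lambda>a. h (G a)) S' f"
proof -
  have hG: "Modules.additive (\<lambda>a. h (G a))"
    by unfold_locales (simp add: additive.add[OF assms(1)] additive.add[OF assms(4)])
  show ?thesis
    by (induction f)
      (simp_all add: additive.zero[OF assms(4)] additive.add[OF assms(4)] assms(5)
        eval_at_pCons[OF assms(1,2)] eval_at_pCons[OF hG assms(3)])
qed

lemma eval_at_diff_fun:
  assumes "Modules.additive G" "Modules.additive H" "Modules.additive S"
  shows "eval_at (\<lambda>a. G a - H a) S f = eval_at G S f - eval_at H S f"
proof -
  have GH: "Modules.additive (\<lambda>a. G a - H a)"
    by unfold_locales (simp add: additive.add[OF assms(1)] additive.add[OF assms(2)])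
  show ?thesis
    by (induction f) (simp_all add: eval_at_pCons assms GH additive.diff[OF assms(3)])
qed

lemma eval_at_map_poly:
  assumes "Modules.additive G" "Modules.additive S" "Modules.additive h"
  shows "eval_at G S (map_poly h f) = eval_at (\<lambda>a. G (h a)) S f"
proof -
  have Gh: "Modules.additive (\<lambda>a. G (h a))"
    by unfold_locales (simp add: additive.add[OF assms(1)] additive.add[OF assms(3)])
  show ?thesis
    by (induction f) (simp_all add: eval_at_pCons assms Gh map_poly_pCons additive.zero[OF assms(3)])
qed

lemma eval_at_pCons_operator:
  assumes "Modules.additive h"
  shows "eval_at (\<lambda>a. [:h a:]) (pCons 0) f = map_poly h f"
proof -
  have 1: "Modules.additive (\<lambda>a. [:h a:])" "Modules.additive (pCons (0::'b))"
    by (unfold_locales) (simp_all add: additive.add[OF assms])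
  show ?thesis
    by (induction f) (simp_all add: eval_at_pCons 1 map_poly_pCons additive.zero[OF assms])
qed

lemma additive_pCons_0: "Modules.additive (pCons (0::'a::ab_group_add))"
  by unfold_locales simp

lemma additive_const_poly: "Modules.additive (\<lambda>a::'a::ab_group_add. [:a:])"
  by unfold_locales simp

lemma additive_map_poly:
  assumes "Modules.additive h" shows "Modules.additive (map_poly h)"
  by unfold_locales
    (auto intro!: poly_eqI simp: coeff_map_poly additive.zero[OF assms] additive.add[OF assms])

lemma additive_plus_fun:
  assumes "Modules.additive f" "Modules.additive g"
  shows "Modules.additive (\<lambda>v. f v + g v)"
  by unfold_locales (simp add: additive.add[OF assms(1)] additive.add[OF assms(2)])

lemma eval_at_const_variable: "eval_at (\<lambda>x. [:x:]) (pCons 0) f = (f :: 'a::ab_group_add poly)"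
  using eval_at_pCons_operator[of "\<lambda>x. x" f] by (simp add: Modules.additive_def)

section \<open>The substitution of \<open>-\<lambda>-\<partial>\<close> for \<open>\<lambda>\<close>\<close>

definition reflect :: "('a::ab_group_add \<Rightarrow> 'a) \<Rightarrow> 'a poly \<Rightarrow> 'a poly" where
  "reflect D = eval_at (\<lambda>x. [:x:]) (\<lambda>f. - pCons 0 f - map_poly D f)"

lemma additive_reflection_operator:
  assumes "Modules.additive D"
  shows "Modules.additive (\<lambda>f. - pCons 0 f - map_poly D f)"
  by unfold_locales (simp add: additive.add[OF additive_map_poly[OF assms]])

lemma additive_reflect:
  assumes "Modules.additive D"
  shows "Modules.additive (reflect D)"
  unfolding reflect_def
  by (rule additive_eval_at[OF additive_const_poly additive_reflection_operator[OF assms]])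

lemma reflect_const:
  assumes "Modules.additive D"
  shows "reflect D [:x:] = [:x:]"
  unfolding reflect_def
  by (rule eval_at_const[OF additive_const_poly additive_reflection_operator[OF assms]])

lemma reflect_pCons_0:
  assumes "Modules.additive D"
  shows "reflect D (pCons 0 f) = - pCons 0 (reflect D f) - map_poly D (reflect D f)"
  unfolding reflect_def
  by (simp add: eval_at_pCons[OF additive_const_poly additive_reflection_operator[OF assms]]
      del: minus_pCons)

text \<open>
  If an additive map turns the variable into \<open>S\<close> and \<open>\<partial>\<close> into \<open>E\<close>, then on reflected polynomials it is
  evaluation at \<open>-S-E\<close>.
\<close>

lemma eval_reflect:
  assumes D: "Modules.additive D" and S: "Modules.additive S" and E: "Modules.additive E"
    and h: "Modules.additive h"
    and hS: "\<And>f. h (pCons 0 f) = S (h f)" and hE: "\<And>f. h (map_poly D f) = E (h f)"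
  shows "h (reflect D f) = eval_at (\<lambda>x. h [:x:]) (\<lambda>v. - S v - E v) f"
proof -
  have "Modules.additive (\<lambda>v. - S v - E v)"
    by unfold_locales (simp add: additive.add[OF S] additive.add[OF E])
  then show ?thesis
    unfolding reflect_def
    by (rule eval_at_natural[OF additive_const_poly additive_reflection_operator[OF D] _ h])
      (simp add: additive.diff[OF h] additive.minus[OF h] hS hE del: minus_pCons)
qed

lemma reflect_map_poly:
  assumes D: "Modules.additive D" and h: "Modules.additive h" and hD: "\<And>x. h (D x) = D (h x)"
  shows "reflect D (map_poly h f) = map_poly h (reflect D f)"
proof -
  let ?S = "\<lambda>f. - pCons 0 f - map_poly D f"
  note S = additive_reflection_operator[OF D]
  note H = additive_map_poly[OF h]
  have "reflect D (map_poly h f) = eval_at (\<lambda>x. map_poly h [:x:]) ?S f"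
    unfolding reflect_def
    by (simp only: eval_at_map_poly[OF additive_const_poly S h] map_poly_pCons map_poly_0
        additive.zero[OF h])
  also have "\<dots> = map_poly h (reflect D f)"
    unfolding reflect_def
    by (rule eval_at_natural[OF additive_const_poly S S H, symmetric])
      (simp add: additive.diff[OF H] additive.minus[OF H] map_poly_pCons map_poly_map_poly
        additive.zero[OF h] additive.zero[OF D] o_def hD del: minus_pCons)
  finally show ?thesis .
qed

text \<open>
  Reflection is an involution because \<open>-\<lambda>-\<partial>\<close> is turned back into \<open>-(-\<lambda>-\<partial>)-\<partial> = \<lambda>\<close>; this is what makes
  commutators skew-symmetric.
\<close>

lemma reflect_reflect:
  assumes D: "Modules.additive D"
  shows "reflect D (reflect D f) = f"
proof -
  note R = additive_reflect[OF D]
  have "reflect D (- pCons 0 g - map_poly D g) = pCons 0 (reflect D g)" for g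
    by (simp add: additive.diff[OF R] additive.minus[OF R] reflect_pCons_0[OF D]
        reflect_map_poly[OF D D] del: minus_pCons)
  then have "reflect D (reflect D f) = eval_at (\<lambda>x. reflect D [:x:]) (pCons 0) f"
    unfolding reflect_def[of D]
    by (intro eval_at_natural additive_const_poly additive_reflection_operator[OF D]
        additive_pCons_0 R[unfolded reflect_def])
  then show ?thesis by (simp add: reflect_const[OF D] eval_at_const_variable)
qed

section \<open>Sesquilinear operations and their commutators\<close>

text \<open>
  Here \<open>L a b\<close> is the polynomial \<open>a\<^sub>\<lambda> b\<close> in \<open>A[\<lambda>]\<close>; multiplication by \<open>\<lambda>\<close> is \<^term>\<open>pCons 0\<close>.
\<close>

locale sesquilinear =
  fixes D :: "'a::ab_group_add \<Rightarrow> 'a" and L :: "'a \<Rightarrow> 'a \<Rightarrow> 'a poly"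
  assumes add_left: "L (a + a') b = L a b + L a' b"
    and add_right: "L a (b + b') = L a b + L a b'"
    and D_left: "L (D a) b = - pCons 0 (L a b)"
    and D_right: "L a (D b) = map_poly D (L a b) + pCons 0 (L a b)"
begin

lemma additive_right: "Modules.additive (L a)"
  by unfold_locales (rule add_right)

end

definition opposite :: "('a::ab_group_add \<Rightarrow> 'a) \<Rightarrow> ('a \<Rightarrow> 'a \<Rightarrow> 'a poly) \<Rightarrow> 'a \<Rightarrow> 'a \<Rightarrow> 'a poly" where
  "opposite D L a b = reflect D (L b a)"

definition commutator :: "('a::ab_group_add \<Rightarrow> 'a) \<Rightarrow> ('a \<Rightarrow> 'a \<Rightarrow> 'a poly) \<Rightarrow> 'a \<Rightarrow> 'a \<Rightarrow> 'a poly" where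
  "commutator D L a b = L a b - opposite D L a b"

lemma opposite_sesquilinear:
  assumes D: "Modules.additive D" and "sesquilinear D L"
  shows "sesquilinear D (opposite D L)"
proof -
  interpret L: sesquilinear D L by fact
  note R = additive_reflect[OF D]
  show ?thesis
    by unfold_locales
      (simp_all add: opposite_def L.add_left L.add_right L.D_left L.D_right additive.add[OF R]
        additive.minus[OF R] reflect_pCons_0[OF D] reflect_map_poly[OF D D] del: minus_pCons)
qed

lemma sesquilinear_diff:
  assumes D: "Modules.additive D" and "sesquilinear D L" "sesquilinear D K"
  shows "sesquilinear D (\<lambda>a b. L a b - K a b)"
proof -
  interpret L: sesquilinear D L by fact
  interpret K: sesquilinear D K by fact
  have [simp]: "map_poly D (f - g) = map_poly D f - map_poly D g" for f g
    by (rule additive.diff[OF additive_map_poly[OF D]])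
  show ?thesis
    by unfold_locales (simp_all add: L.add_left K.add_left L.add_right K.add_right L.D_left K.D_left
      L.D_right K.D_right)
qed

lemma commutator_sesquilinear:
  assumes "Modules.additive D" and "sesquilinear D L"
  shows "sesquilinear D (commutator D L)"
  unfolding commutator_def[abs_def]
  using assms by (intro sesquilinear_diff opposite_sesquilinear)

lemma opposite_commutator:
  assumes "Modules.additive D"
  shows "opposite D (commutator D L) a b = - commutator D L a b"
  by (simp add: commutator_def opposite_def additive.diff[OF additive_reflect[OF assms]]
      reflect_reflect[OF assms])

text \<open>With multiplication by a scalar for \<open>h\<close>, this yields homogeneity of the commutator in each argument.\<close>

lemma commutator_map_poly:
  assumes D: "Modules.additive D" and h: "Modules.additive h" and hD: "\<And>x. h (D x) = D (h x)"
    and "L a' b' = map_poly h (L a b)" "L b' a' = map_poly h (L b a)"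
  shows "commutator D L a' b' = map_poly h (commutator D L a b)"
  by (simp only: commutator_def opposite_def assms reflect_map_poly[OF D h hD]
      additive.diff[OF additive_map_poly[OF h]])

section \<open>Products and triple products at operators\<close>

text \<open>
  \<open>V\<close> is any abelian group with an operator \<open>d\<close> extending \<open>\<partial>\<close>, into which \<open>A\<close> is mapped by \<open>\<iota>\<close>; it is the home
  of products at operators.  In the application \<open>V\<close> is \<open>A[\<lambda>,\<mu>]\<close>.
\<close>

locale differential_target =
  fixes D :: "'a::ab_group_add \<Rightarrow> 'a" and \<iota> :: "'a \<Rightarrow> 'v::ab_group_add" and d :: "'v \<Rightarrow> 'v"
  assumes additive_D: "Modules.additive D" and additive_iota: "Modules.additive \<iota>"
    and additive_d: "Modules.additive d" and d_iota: "d (\<iota> a) = \<iota> (D a)"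
begin

definition admissible :: "('v \<Rightarrow> 'v) \<Rightarrow> bool" where
  "admissible S \<longleftrightarrow> Modules.additive S \<and> (\<forall>v. S (d v) = d (S v))"

definition product_at :: "('v \<Rightarrow> 'v) \<Rightarrow> ('a \<Rightarrow> 'a \<Rightarrow> 'a poly) \<Rightarrow> 'a \<Rightarrow> 'a \<Rightarrow> 'v" where
  "product_at S L a b = eval_at \<iota> S (L a b)"

text \<open>
  The two ways of bracketing three factors, \<open>a\<^sub>S(b\<^sub>T c)\<close> and \<open>(a\<^sub>S b)\<^sub>T c\<close>.  The outer product is taken with
  \<open>L\<close>, the inner one with \<open>K\<close>; they are different coefficients of the deformed product later on.
\<close>

definition right_triple where
  "right_triple S T L K a b c = eval_at (product_at S L a) T (K b c)"

definition left_triple where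
  "left_triple S T L K a b c = eval_at (\<lambda>x. product_at T L x c) S (K a b)"

lemma eval_at_iota_D:
  assumes "admissible S"
  shows "eval_at \<iota> S (map_poly D f) = d (eval_at \<iota> S f)"
proof -
  have S: "Modules.additive S" "\<And>v. d (S v) = S (d v)" using assms by (auto simp: admissible_def)
  have "eval_at \<iota> S (map_poly D f) = eval_at (\<lambda>a. d (\<iota> a)) S f"
    by (simp add: eval_at_map_poly additive_iota S additive_D d_iota)
  also have "\<dots> = d (eval_at \<iota> S f)"
    by (rule eval_at_natural[symmetric]) (auto simp: additive_iota S additive_d)
  finally show ?thesis .
qed

context
  fixes L :: "'a \<Rightarrow> 'a \<Rightarrow> 'a poly" and S :: "'v \<Rightarrow> 'v"
  assumes L: "sesquilinear D L" and S: "admissible S"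
begin

interpretation L: sesquilinear D L by (rule L)

lemma S_additive: "Modules.additive S" using S by (simp add: admissible_def)

lemmas eval_simps = additive.minus[OF S_additive]
  eval_at_pCons[OF additive_iota S_additive] eval_at_add[OF additive_iota S_additive]
  additive.minus[OF additive_eval_at[OF additive_iota S_additive]]
  additive.diff[OF additive_eval_at[OF additive_iota S_additive]] additive.zero[OF additive_iota]

lemma product_at_additive_left: "Modules.additive (\<lambda>a. product_at S L a b)"
  by unfold_locales (simp add: product_at_def L.add_left eval_simps)

lemma product_at_additive_right: "Modules.additive (product_at S L a)"
  by unfold_locales (simp add: product_at_def L.add_right eval_simps)

lemma product_at_D_left: "product_at S L (D a) b = - S (product_at S L a b)"
  by (simp add: product_at_def L.D_left eval_simps)

lemma product_at_D_right: "product_at S L a (D b) = d (product_at S L a b) + S (product_at S L a b)"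
  by (simp add: product_at_def L.D_right eval_simps eval_at_iota_D[OF S])

text \<open>Reflection makes the opposite product at \<open>S\<close> the product at \<open>-S-\<partial>\<close>: \<open>b\<^sub>-\<^sub>S\<^sub>-\<^sub>\<partial> a\<close>.\<close>

lemma product_at_opposite: "product_at S (opposite D L) a b = product_at (\<lambda>v. - S v - d v) L b a"
  unfolding product_at_def opposite_def
  by (subst eval_reflect[OF additive_D S_additive additive_d additive_eval_at[OF additive_iota S_additive]])
    (simp_all add: eval_simps eval_at_iota_D[OF S] additive.zero[OF S_additive])

end

definition commuting :: "('v \<Rightarrow> 'v) \<Rightarrow> ('v \<Rightarrow> 'v) \<Rightarrow> bool" where
  "commuting S T \<longleftrightarrow> admissible S \<and> admissible T \<and> (\<forall>v. S (T v) = T (S v))"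

lemma admissible_plus: "admissible S \<Longrightarrow> admissible T \<Longrightarrow> admissible (\<lambda>v. S v + T v)"
  by (auto simp: admissible_def Modules.additive_def additive.add[OF additive_d])

lemma admissible_minus: "admissible S \<Longrightarrow> admissible T \<Longrightarrow> admissible (\<lambda>v. S v - T v)"
  by (auto simp: admissible_def Modules.additive_def additive.diff[OF additive_d])

lemma admissible_uminus: "admissible S \<Longrightarrow> admissible (\<lambda>v. - S v)"
  by (auto simp: admissible_def Modules.additive_def additive.minus[OF additive_d])

lemma admissible_d: "admissible d"
  by (auto simp: admissible_def additive_d)

lemmas admissible_intros = admissible_plus admissible_minus admissible_uminus admissible_d

context
  fixes S T :: "'v \<Rightarrow> 'v"
  assumes ST: "commuting S T"
begin

lemma commuting_admissible: "admissible S" "admissible T" and commuting_swap: "S (T v) = T (S v)"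
  using ST by (auto simp: commuting_def)

lemma commuting_additive: "Modules.additive S" "Modules.additive T"
  using commuting_admissible by (auto simp: admissible_def)

lemma commuting_d: "S (d v) = d (S v)" "T (d v) = d (T v)"
  using commuting_admissible by (auto simp: admissible_def)

lemmas commuting_simps = additive.minus[OF commuting_additive(1)] additive.minus[OF commuting_additive(2)]
  additive.add[OF commuting_additive(1)] additive.add[OF commuting_additive(2)]
  additive.diff[OF commuting_additive(1)] additive.diff[OF commuting_additive(2)]
  commuting_d commuting_swap

end

context
  fixes L K :: "'a \<Rightarrow> 'a \<Rightarrow> 'a poly" and S T :: "'v \<Rightarrow> 'v"
  assumes L: "sesquilinear D L" and ST: "commuting S T"
begin

private lemmas S = commuting_admissible(1)[OF ST] and T = commuting_admissible(2)[OF ST]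
  and Sa = commuting_additive(1)[OF ST] and Ta = commuting_additive(2)[OF ST]
  and op_simps = commuting_simps[OF ST]

text \<open>
  In \<open>a\<^sub>S(b\<^sub>T c)\<close> the factors carry the variables \<open>S\<close>, \<open>T\<close>, \<open>-S-T-\<partial>\<close>, and in \<open>(a\<^sub>S b)\<^sub>T c\<close> they carry \<open>S\<close>, \<open>T-S\<close>,
  \<open>-T-\<partial>\<close>.  In each of the next four lemmas the opposite product swaps its two factors, which keep their
  variables.  When the inner product is replaced by its opposite,
  the \<open>\<partial>\<close> in the reflected variable meets the outer product and contributes through sesquilinearity:
  \<open>d + S\<close> if the inner product is the right factor, \<open>-T\<close> if it is the left factor.
\<close>

lemma right_triple_opposite_right:
  "right_triple S T L (opposite D K) a b c
    = right_triple S (\<lambda>v. - S v - T v - d v) L K a c b"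
proof -
  let ?h = "eval_at (product_at S L a) T"
  note G = product_at_additive_right[OF L S, of a]
  note h = additive_eval_at[OF G Ta]
  have dS: "Modules.additive (\<lambda>v. d v + S v)"
    using admissible_plus[OF admissible_d S] by (simp add: admissible_def)
  have hd: "?h (map_poly D f) = d (?h f) + S (?h f)" for f
  proof -
    have "?h (map_poly D f) = eval_at (\<lambda>x. d (product_at S L a x) + S (product_at S L a x)) T f"
      by (simp add: eval_at_map_poly G Ta additive_D product_at_D_right[OF L S])
    also have "\<dots> = d (?h f) + S (?h f)"
      by (rule eval_at_natural[OF G Ta Ta dS, symmetric]) (simp add: op_simps)
    finally show ?thesis .
  qed
  have "?h (reflect D f) = eval_at (\<lambda>x. ?h [:x:]) (\<lambda>v. - T v - (d v + S v)) f" for f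
    by (rule eval_reflect[OF additive_D Ta dS h])
      (simp_all add: hd eval_at_pCons[OF G Ta] additive.zero[OF G])
  moreover have "(\<lambda>v. - T v - (d v + S v)) = (\<lambda>v. - S v - T v - d v)"
    by (simp add: fun_eq_iff)
  ultimately show ?thesis
    by (simp add: right_triple_def opposite_def eval_at_const[OF G Ta])
qed

lemma left_triple_opposite_right:
  "left_triple S T L (opposite D K) a b c = left_triple (\<lambda>v. T v - S v) T L K b a c"
proof -
  let ?h = "eval_at (\<lambda>x. product_at T L x c) S"
  note G = product_at_additive_left[OF L T, of c]
  note h = additive_eval_at[OF G Sa]
  have mT: "Modules.additive (\<lambda>v. - T v)"
    using admissible_uminus[OF T] by (simp add: admissible_def)
  have hd: "?h (map_poly D f) = - T (?h f)" for f
  proof -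
    have "?h (map_poly D f) = eval_at (\<lambda>x. - T (product_at T L x c)) S f"
      by (simp add: eval_at_map_poly G Sa additive_D product_at_D_left[OF L T])
    also have "\<dots> = - T (?h f)"
      by (rule eval_at_natural[OF G Sa Sa mT, symmetric]) (simp add: op_simps)
    finally show ?thesis .
  qed
  have "?h (reflect D f) = eval_at (\<lambda>x. ?h [:x:]) (\<lambda>v. - S v - (- T v)) f" for f
    by (rule eval_reflect[OF additive_D Sa mT h])
      (simp_all add: hd eval_at_pCons[OF G Sa] additive.zero[OF G])
  moreover have "(\<lambda>v. - S v - (- T v)) = (\<lambda>v. T v - S v)"
    by (simp add: fun_eq_iff)
  ultimately show ?thesis
    by (simp add: left_triple_def opposite_def eval_at_const[OF G Sa])
qed

lemma right_triple_opposite_left: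
  "right_triple S T (opposite D L) K a b c = left_triple T (\<lambda>v. - S v - d v) L K b c a"
proof -
  have "product_at S (opposite D L) a = (\<lambda>x. product_at (\<lambda>v. - S v - d v) L x a)"
    by (rule ext) (rule product_at_opposite[OF L S])
  then show ?thesis by (simp add: right_triple_def left_triple_def)
qed

lemma left_triple_opposite_left:
  "left_triple S T (opposite D L) K a b c = right_triple (\<lambda>v. - T v - d v) S L K c a b"
  by (simp add: right_triple_def left_triple_def product_at_opposite[OF L T])

end

lemma commuting_snd_complement:
  assumes ST: "commuting S T" shows "commuting T (\<lambda>v. - S v - d v)"
  using commuting_admissible[OF ST] commuting_simps[OF ST]
  by (auto simp: commuting_def intro!: admissible_intros)

lemma commuting_complement_fst:
  assumes ST: "commuting S T" shows "commuting (\<lambda>v. - T v - d v) S"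
  using commuting_admissible[OF ST] commuting_simps[OF ST]
  by (auto simp: commuting_def intro!: admissible_intros)

lemma commuting_third:
  assumes ST: "commuting S T"
  shows "commuting S (\<lambda>v. - S v - T v - d v)"
  using commuting_admissible[OF ST] commuting_simps[OF ST]
  by (auto simp: commuting_def intro!: admissible_intros)

lemma commuting_sym: "commuting S T \<Longrightarrow> commuting T S"
  by (auto simp: commuting_def)

lemma product_at_diff:
  assumes "admissible S"
  shows "product_at S (\<lambda>a b. L a b - K a b) a b = product_at S L a b - product_at S K a b"
  using assms unfolding product_at_def admissible_def
  by (simp add: additive.diff[OF additive_eval_at[OF additive_iota]])

lemma right_triple_diff_right:
  assumes "sesquilinear D L" "commuting S T"
  shows "right_triple S T L (\<lambda>a b. K a b - K' a b) a b c
    = right_triple S T L K a b c - right_triple S T L K' a b c"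
  unfolding right_triple_def
  using commuting_additive(2)[OF assms(2)] commuting_admissible(1)[OF assms(2)]
  by (simp add: additive.diff[OF additive_eval_at] product_at_additive_right assms(1))

lemma left_triple_diff_right:
  assumes "sesquilinear D L" "commuting S T"
  shows "left_triple S T L (\<lambda>a b. K a b - K' a b) a b c
    = left_triple S T L K a b c - left_triple S T L K' a b c"
  unfolding left_triple_def
  using commuting_additive(1)[OF assms(2)] commuting_admissible(2)[OF assms(2)]
  by (simp add: additive.diff[OF additive_eval_at] product_at_additive_left assms(1))

lemma right_triple_diff_left:
  assumes "sesquilinear D L" "sesquilinear D L'" "commuting S T"
  shows "right_triple S T (\<lambda>a b. L a b - L' a b) K a b c
    = right_triple S T L K a b c - right_triple S T L' K a b c"
proof -
  have "product_at S (\<lambda>a b. L a b - L' a b) a = (\<lambda>x. product_at S L a x - product_at S L' a x)"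
    by (rule ext) (rule product_at_diff[OF commuting_admissible(1)[OF assms(3)]])
  then show ?thesis
    unfolding right_triple_def
    by (simp add: eval_at_diff_fun product_at_additive_right assms
        commuting_admissible(1)[OF assms(3)] commuting_additive(2)[OF assms(3)])
qed

lemma left_triple_diff_left:
  assumes "sesquilinear D L" "sesquilinear D L'" "commuting S T"
  shows "left_triple S T (\<lambda>a b. L a b - L' a b) K a b c
    = left_triple S T L K a b c - left_triple S T L' K a b c"
  unfolding left_triple_def product_at_diff[OF commuting_admissible(2)[OF assms(3)]]
  by (simp add: eval_at_diff_fun product_at_additive_left assms
      commuting_admissible(2)[OF assms(3)] commuting_additive(1)[OF assms(3)])

context
  fixes L K :: "'a \<Rightarrow> 'a \<Rightarrow> 'a poly" and S T :: "'v \<Rightarrow> 'v"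
  assumes L: "sesquilinear D L" and ST: "commuting S T"
begin

lemma right_triple_commutator_left:
  "right_triple S T (commutator D L) K a b c
    = right_triple S T L K a b c - left_triple T (\<lambda>v. - S v - d v) L K b c a"
  unfolding commutator_def[abs_def]
  by (simp add: right_triple_diff_left opposite_sesquilinear L ST additive_D
      right_triple_opposite_left)

lemma left_triple_commutator_right:
  "left_triple S T L (commutator D K) a b c
    = left_triple S T L K a b c - left_triple (\<lambda>v. T v - S v) T L K b a c"
  unfolding commutator_def[abs_def]
  by (simp add: left_triple_diff_right opposite_sesquilinear L ST additive_D
      left_triple_opposite_right)

lemma right_triple_commutator_right:
  "right_triple S T L (commutator D K) a b c
    = right_triple S T L K a b c - right_triple S (\<lambda>v. - S v - T v - d v) L K a c b"
  unfolding commutator_def[abs_def]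
  by (simp add: right_triple_diff_right opposite_sesquilinear L ST additive_D
      right_triple_opposite_right)

lemma left_triple_commutator_left:
  "left_triple S T (commutator D L) K a b c
    = left_triple S T L K a b c - right_triple (\<lambda>v. - T v - d v) S L K c a b"
  unfolding commutator_def[abs_def]
  by (simp add: left_triple_diff_left opposite_sesquilinear L ST additive_D
      left_triple_opposite_left)

end

lemma right_triple_commutators:
  assumes L: "sesquilinear D L" and ST: "commuting S T"
  shows "right_triple S T (commutator D L) (commutator D K) a b c
    = right_triple S T L K a b c - right_triple S (\<lambda>v. - S v - T v - d v) L K a c b
      - (left_triple T (\<lambda>v. - S v - d v) L K b c a
         - left_triple (\<lambda>v. - S v - T v - d v) (\<lambda>v. - S v - d v) L K c b a)"
proof -
  have [simp]: "(\<lambda>v. - S v - d v - T v) = (\<lambda>v. - S v - T v - d v)"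
    by (simp add: algebra_simps)
  show ?thesis
    by (simp add: right_triple_commutator_left[OF L ST]
      right_triple_commutator_right[OF L ST]
      left_triple_commutator_right[OF L commuting_snd_complement[OF ST]])
qed

lemma left_triple_commutators:
  assumes L: "sesquilinear D L" and ST: "commuting S T"
  shows "left_triple S T (commutator D L) (commutator D K) a b c
    = left_triple S T L K a b c - left_triple (\<lambda>v. T v - S v) T L K b a c
      - (right_triple (\<lambda>v. - T v - d v) S L K c a b
         - right_triple (\<lambda>v. - T v - d v) (\<lambda>v. T v - S v) L K c b a)"
  by (simp add: left_triple_commutator_left[OF L ST]
      left_triple_commutator_right[OF L ST]
      right_triple_commutator_right[OF L commuting_complement_fst[OF ST]])

lemma triple_zero:
  assumes "commuting S T"
  shows "right_triple S T L (\<lambda>_ _. 0) a b c = 0" "left_triple S T L (\<lambda>_ _. 0) a b c = 0"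
    "right_triple S T (\<lambda>_ _. 0) K a b c = 0" "left_triple S T (\<lambda>_ _. 0) K a b c = 0"
proof -
  have z: "Modules.additive (\<lambda>_::'a. 0::'v)"
    by unfold_locales simp
  have "eval_at (\<lambda>_. 0) S f = 0" if "Modules.additive S" for S :: "'v \<Rightarrow> 'v" and f :: "'a poly"
    by (induction f) (simp_all add: eval_at_pCons[OF z that] additive.zero[OF that])
  moreover have "product_at S (\<lambda>_ _. 0) = (\<lambda>_ _. 0)" for S
    by (simp add: product_at_def fun_eq_iff)
  ultimately show "right_triple S T (\<lambda>_ _. 0) K a b c = 0" "left_triple S T (\<lambda>_ _. 0) K a b c = 0"
    using commuting_additive[OF assms] by (simp_all add: right_triple_def left_triple_def)
qed (simp_all add: right_triple_def left_triple_def)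

section \<open>Leibniz rule and Jacobi identity for commutators\<close>

text \<open>
  Associativity is needed only in total, summed over a family of pairs of operations: in the
  application the pairs are \<open>(\<mu>\<^sub>m, \<mu>\<^sub>k\<^sub>-\<^sub>m)\<close> with \<open>m \<le> k\<close>, which need not be associative one by one when \<open>k > 0\<close>.  Expanding
  the commutators is possible pair by pair, so it commutes with the summation.
\<close>

context
  fixes I :: "'s set" and L K :: "'s \<Rightarrow> 'a \<Rightarrow> 'a \<Rightarrow> 'a poly"
  assumes L: "\<And>s. s \<in> I \<Longrightarrow> sesquilinear D (L s)"
    and assoc: "\<And>S T a b c. commuting S T \<Longrightarrow>
      (\<Sum>s\<in>I. right_triple S T (L s) (K s) a b c)
        = (\<Sum>s\<in>I. left_triple S (\<lambda>v. S v + T v) (L s) (K s) a b c)"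
begin

text \<open>
  In total, both sides equal \<open>a\<^sub>S(b\<^sub>T c) - b\<^sub>T(c\<^sub>N a)\<close> with \<open>N = -S-T-\<partial>\<close>; on the right the terms \<open>(b\<^sub>T a)\<^sub>S\<^sub>+\<^sub>T c\<close> and
  \<open>b\<^sub>T(a\<^sub>S c)\<close> cancel.
\<close>

lemma commutator_Leibniz:
  assumes ST: "commuting S T"
  shows "(\<Sum>s\<in>I. right_triple S T (commutator D (L s)) (K s) a b c)
    = (\<Sum>s\<in>I. left_triple S (\<lambda>v. S v + T v) (L s) (commutator D (K s)) a b c)
      + (\<Sum>s\<in>I. right_triple T S (L s) (commutator D (K s)) b a c)"
proof -
  let ?N = "\<lambda>v. - S v - T v - d v"
  note TS = commuting_sym[OF ST]
  have "(\<lambda>v. - T v - S v - d v) = ?N" by (simp add: fun_eq_iff)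
  then have TN: "commuting T ?N"
    using commuting_third[OF TS] by simp
  have SST: "commuting S (\<lambda>v. S v + T v)"
    using commuting_admissible[OF ST] commuting_simps[OF ST]
    by (auto simp: commuting_def intro!: admissible_intros)
  have e: "(\<lambda>v. - T v - S v - d v) = ?N" "(\<lambda>v. T v + ?N v) = (\<lambda>v. - S v - d v)"
     "(\<lambda>v. T v + S v) = (\<lambda>v. S v + T v)"
    by (simp_all add: fun_eq_iff algebra_simps)
  have "(\<Sum>s\<in>I. right_triple S T (commutator D (L s)) (K s) a b c)
    = (\<Sum>s\<in>I. right_triple S T (L s) (K s) a b c)
      - (\<Sum>s\<in>I. left_triple T (\<lambda>v. - S v - d v) (L s) (K s) b c a)"
    by (simp add: right_triple_commutator_left L ST flip: sum_subtractf)
  also have "\<dots> = (\<Sum>s\<in>I. left_triple S (\<lambda>v. S v + T v) (L s) (K s) a b c)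
      - (\<Sum>s\<in>I. right_triple T ?N (L s) (K s) b c a)"
    using assoc[OF ST, of a b c] assoc[OF TN, of b c a] unfolding e by simp
  finally have lhs: "(\<Sum>s\<in>I. right_triple S T (commutator D (L s)) (K s) a b c) = \<dots>" .
  have r1: "(\<Sum>s\<in>I. left_triple S (\<lambda>v. S v + T v) (L s) (commutator D (K s)) a b c)
    = (\<Sum>s\<in>I. left_triple S (\<lambda>v. S v + T v) (L s) (K s) a b c)
      - (\<Sum>s\<in>I. left_triple T (\<lambda>v. S v + T v) (L s) (K s) b a c)"
    by (simp add: left_triple_commutator_right L SST flip: sum_subtractf)
  have r2: "(\<Sum>s\<in>I. right_triple T S (L s) (commutator D (K s)) b a c)
    = (\<Sum>s\<in>I. left_triple T (\<lambda>v. S v + T v) (L s) (K s) b a c)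
      - (\<Sum>s\<in>I. right_triple T ?N (L s) (K s) b c a)"
    using assoc[OF TS, of b a c] unfolding e
    by (simp add: right_triple_commutator_right L TS sum_subtractf e)
  show ?thesis unfolding lhs r1 r2 by simp
qed

text \<open>
  After associativity is used to write every triple product as some \<open>U\<close> with variables from \<open>S\<close>, \<open>T\<close>, \<open>N\<close>,
  where \<open>N = -S-T-\<partial>\<close>, the right-hand side has eight terms; two are \<open>\<plusminus>U\<^sub>T\<^sub>S(b,a,c)\<close>, two are \<open>\<plusminus>U\<^sub>N\<^sub>S(c,a,b)\<close>,
  and the other four make up the left-hand side.
\<close>

lemma commutator_Jacobi:
  assumes ST: "commuting S T"
  shows "(\<Sum>s\<in>I. right_triple S T (commutator D (L s)) (commutator D (K s)) a b c)
    = (\<Sum>s\<in>I. left_triple S (\<lambda>v. S v + T v) (commutator D (L s)) (commutator D (K s)) a b c)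
      + (\<Sum>s\<in>I. right_triple T S (commutator D (L s)) (commutator D (K s)) b a c)"
proof -
  let ?N = "\<lambda>v. - S v - T v - d v"
  define U where "U S T a b c = (\<Sum>s\<in>I. right_triple S T (L s) (K s) a b c)" for S T a b c
  define V where "V S T a b c = (\<Sum>s\<in>I. left_triple S T (L s) (K s) a b c)" for S T a b c
  note TS = commuting_sym[OF ST]
  have SN: "commuting S ?N" by (rule commuting_third[OF ST])
  have "(\<lambda>v. - T v - S v - d v) = ?N" by (simp add: fun_eq_iff)
  then have TN: "commuting T ?N"
    using commuting_third[OF TS] by simp
  have SST: "commuting S (\<lambda>v. S v + T v)"
    using commuting_admissible[OF ST] commuting_simps[OF ST]
    by (auto simp: commuting_def intro!: admissible_intros)
  have e: "(\<lambda>v. - T v - S v - d v) = ?N" "(\<lambda>v. T v + ?N v) = (\<lambda>v. - S v - d v)"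
     "(\<lambda>v. ?N v + T v) = (\<lambda>v. - S v - d v)" "(\<lambda>v. S v + ?N v) = (\<lambda>v. - T v - d v)"
     "(\<lambda>v. ?N v + S v) = (\<lambda>v. - T v - d v)"
     "(\<lambda>v. T v + S v) = (\<lambda>v. S v + T v)"
    by (simp_all add: fun_eq_iff algebra_simps)
  have UV: "U S T a b c = V S (\<lambda>v. S v + T v) a b c" if "commuting S T" for S T a b c
    unfolding U_def V_def by (rule assoc[OF that])
  note UVs = UV[OF ST] UV[OF TS] UV[OF SN] UV[OF TN] UV[OF commuting_sym[OF SN]] UV[OF commuting_sym[OF TN]]
  have right: "(\<Sum>s\<in>I. right_triple S T (commutator D (L s)) (commutator D (K s)) a b c)
    = U S T a b c - U S (\<lambda>v. - S v - T v - d v) a c b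
      - (V T (\<lambda>v. - S v - d v) b c a - V (\<lambda>v. - S v - T v - d v) (\<lambda>v. - S v - d v) c b a)"
    if "commuting S T" for S T a b c
    unfolding U_def V_def by (simp add: right_triple_commutators L that flip: sum_subtractf)
  have left: "(\<Sum>s\<in>I. left_triple S (\<lambda>v. S v + T v) (commutator D (L s)) (commutator D (K s)) a b c)
    = V S (\<lambda>v. S v + T v) a b c - V T (\<lambda>v. S v + T v) b a c - (U ?N S c a b - U ?N T c b a)"
  proof -
    have "(\<lambda>v. - (S v + T v) - d v) = ?N" by (simp add: fun_eq_iff)
    then show ?thesis
      unfolding U_def V_def by (simp add: left_triple_commutators L SST flip: sum_subtractf)
  qed
  show ?thesis
    unfolding right[OF ST] left right[OF TS] e UVs by (simp add: algebra_simps)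
qed

end

end

section \<open>Two formal variables\<close>

text \<open>
  \<open>A[\<lambda>,\<mu>]\<close> is \<^typ>\<open>'a poly poly\<close>: the outer variable is \<open>\<mu>\<close>, the inner one is \<open>\<lambda>\<close>.  Thus the coefficient of
  \<open>\<lambda>\<^sup>i \<mu>\<^sup>j\<close> is the \<open>i\<close>-th coefficient of the \<open>j\<close>-th coefficient.
\<close>

abbreviation lambda_shift :: "'a::ab_group_add poly poly \<Rightarrow> 'a poly poly" where
  "lambda_shift \<equiv> map_poly (pCons 0)"

abbreviation mu_shift :: "'a::ab_group_add poly poly \<Rightarrow> 'a poly poly" where
  "mu_shift \<equiv> pCons 0"

lemma differential_target_poly_poly:
  assumes D: "Modules.additive D"
  shows "differential_target D (\<lambda>a. [:[:a:]:]) (map_poly (map_poly D))"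
  by (intro differential_target.intro additive_map_poly D)
    (simp_all add: Modules.additive_def map_poly_pCons additive.zero[OF D])

locale two_variables =
  fixes D :: "'a::ab_group_add \<Rightarrow> 'a"
  assumes D: "Modules.additive D"
begin

sublocale differential_target D "\<lambda>a. [:[:a:]:]" "map_poly (map_poly D)"
  by (rule differential_target_poly_poly[OF D])

lemma commuting_shifts: "commuting lambda_shift mu_shift"
  unfolding commuting_def admissible_def
  by (auto simp: additive_map_poly additive_pCons_0 map_poly_map_poly D additive.zero[OF D]
    map_poly_pCons o_def additive.zero[OF additive_map_poly[OF D]])

text \<open>
  Associativity for the variables \<open>\<lambda>\<close> and \<open>\<mu>\<close> is universal: substituting \<open>S\<close> for \<open>\<lambda>\<close> and \<open>T\<close> for \<open>\<mu>\<close>, which is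
  the map \<open>\<Phi>\<close> below, yields associativity for every commuting pair of operators.
\<close>

lemma associative_transfer:
  assumes L: "\<And>s. s \<in> I \<Longrightarrow> sesquilinear D (L s)"
    and assoc: "\<And>a b c.
      (\<Sum>s\<in>I. right_triple lambda_shift mu_shift (L s) (K s) a b c)
        = (\<Sum>s\<in>I. left_triple lambda_shift (\<lambda>v. lambda_shift v + mu_shift v) (L s) (K s) a b c)"
    and ST: "commuting S T"
  shows "(\<Sum>s\<in>I. right_triple S T (L s) (K s) a b c)
        = (\<Sum>s\<in>I. left_triple S (\<lambda>v. S v + T v) (L s) (K s) a b c)"
proof -
  define \<Phi> where "\<Phi> = eval_at (eval_at (\<lambda>a. [:[:a:]:]) S) T"
  note Sa = commuting_additive(1)[OF ST] and Ta = commuting_additive(2)[OF ST]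
  note G = additive_eval_at[OF additive_iota Sa]
  have STa: "Modules.additive (\<lambda>v. S v + T v)" by (rule additive_plus_fun[OF Sa Ta])
  have sha: "Modules.additive (\<lambda>v. lambda_shift v + mu_shift v)"
    by (intro additive_plus_fun additive_map_poly additive_pCons_0)
  have \<Phi>: "Modules.additive \<Phi>" unfolding \<Phi>_def by (rule additive_eval_at[OF G Ta])
  have mu: "\<Phi> (mu_shift v) = T (\<Phi> v)" for v
    unfolding \<Phi>_def by (simp add: eval_at_pCons[OF G Ta])
  have lam: "\<Phi> (lambda_shift v) = S (\<Phi> v)" for v
  proof -
    have "\<Phi> (lambda_shift v) = eval_at (\<lambda>g. S (eval_at (\<lambda>a. [:[:a:]:]) S g)) T v"
      unfolding \<Phi>_def
      by (simp add: eval_at_map_poly[OF G Ta] additive_pCons_0 eval_at_pCons[OF additive_iota Sa])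
    also have "\<dots> = S (\<Phi> v)" unfolding \<Phi>_def
      by (rule eval_at_natural[OF G Ta Ta Sa, symmetric]) (simp add: commuting_simps[OF ST])
    finally show ?thesis .
  qed
  have iota: "\<Phi> [:[:a:]:] = [:[:a:]:]" for a
    unfolding \<Phi>_def by (simp add: eval_at_const G Ta additive_iota Sa)
  have product_at_lam: "\<Phi> (product_at lambda_shift L a b) = product_at S L a b" for L a b
    unfolding product_at_def
    using eval_at_natural[OF additive_iota additive_map_poly[OF additive_pCons_0] Sa \<Phi>] lam iota by simp
  have product_at_sum: "\<Phi> (product_at (\<lambda>v. lambda_shift v + mu_shift v) L a b) = product_at (\<lambda>v. S v + T v) L a b" for L a b
    unfolding product_at_def
    using eval_at_natural[OF additive_iota sha STa \<Phi>] lam mu iota by (simp add: additive.add[OF \<Phi>])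
  have adm: "admissible lambda_shift" "admissible (\<lambda>v. lambda_shift v + mu_shift v)"
    using commuting_admissible[OF commuting_shifts] by (auto intro: admissible_plus)
  have "\<Phi> (right_triple lambda_shift mu_shift (L s) (K s) a b c) = right_triple S T (L s) (K s) a b c" if "s \<in> I" for s
    unfolding right_triple_def
    using eval_at_natural[OF product_at_additive_right[OF L[OF that] adm(1)] additive_pCons_0 Ta \<Phi> mu]
    by (simp add: product_at_lam)
  moreover have "\<Phi> (left_triple lambda_shift (\<lambda>v. lambda_shift v + mu_shift v) (L s) (K s) a b c)
      = left_triple S (\<lambda>v. S v + T v) (L s) (K s) a b c" if "s \<in> I" for s
    unfolding left_triple_def
    using eval_at_natural[OF product_at_additive_left[OF L[OF that] adm(2)]
        additive_map_poly[OF additive_pCons_0] Sa \<Phi> lam]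
    by (simp add: product_at_sum)
  moreover have "(\<Sum>s\<in>I. \<Phi> (right_triple lambda_shift mu_shift (L s) (K s) a b c)) =
      (\<Sum>s\<in>I. \<Phi> (left_triple lambda_shift (\<lambda>v. lambda_shift v + mu_shift v) (L s) (K s) a b c))"
    using arg_cong[OF assoc[of a b c], of \<Phi>] by (simp add: additive.sum[OF \<Phi>])
  ultimately show ?thesis by simp
qed

end

lemma coeff_eval_at_lambda_shift:
  assumes "Modules.additive G"
  shows "Polynomial.coeff (Polynomial.coeff (eval_at G lambda_shift f) j) i
    = (\<Sum>k\<le>i. Polynomial.coeff (Polynomial.coeff (G (Polynomial.coeff f k)) j) (i - k))"
proof (induction f arbitrary: i)
  case 0
  then show ?case by (simp add: additive.zero[OF assms])
next
  case (pCons a f)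
  show ?case
  proof (cases i)
    case 0
    then show ?thesis
      by (simp add: eval_at_pCons[OF assms additive_map_poly[OF additive_pCons_0]] coeff_map_poly)
  next
    case (Suc i')
    show ?thesis
      unfolding Suc sum.atMost_Suc_shift
      by (simp add: eval_at_pCons[OF assms additive_map_poly[OF additive_pCons_0]] coeff_map_poly
        pCons.IH)
  qed
qed

text \<open>This is the binomial theorem for \<open>(\<lambda> + \<mu>)\<^sup>n\<close>; each step of the induction is Pascal's rule.\<close>

lemma coeff_eval_at_sum_shift:
  assumes "Vector_Spaces.vector_space (scl :: 'k::field \<Rightarrow> 'a::ab_group_add \<Rightarrow> 'a)"
  shows "Polynomial.coeff (Polynomial.coeff (eval_at (\<lambda>a. [:[:a:]:]) (\<lambda>v. lambda_shift v + mu_shift v) f) j) i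
    = scl (of_nat ((i + j) choose j)) (Polynomial.coeff f (i + j))"
proof (induction f arbitrary: i j)
  interpret V: Vector_Spaces.vector_space scl by fact
  case 0
  then show ?case by simp
next
  interpret V: Vector_Spaces.vector_space scl by fact
  case (pCons a f)
  have add: "Modules.additive (\<lambda>a::'a. [:[:a:]:])" "Modules.additive (\<lambda>v::'a poly poly. lambda_shift v + mu_shift v)"
    by (auto intro!: additive_plus_fun additive_map_poly additive_pCons_0) (simp add: Modules.additive_def)
  show ?case
    unfolding eval_at_pCons[OF add]
    by (cases i; cases j) (simp_all add: coeff_map_poly pCons.IH V.scale_left_distrib coeff_pCons split: nat.splits)
qed

lemma (in two_variables) coeff_right_triple:
  assumes "sesquilinear D L"
  shows "Polynomial.coeff (Polynomial.coeff (right_triple lambda_shift mu_shift L K a b c) j) i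
    = Polynomial.coeff (L a (Polynomial.coeff (K b c) j)) i"
proof -
  have const: "eval_at (\<lambda>x. [:[:x:]:]) lambda_shift f = [:f:]" for f :: "'a poly"
  proof -
    have "[:eval_at (\<lambda>x. [:x:]) (pCons 0) f:] = eval_at (\<lambda>x. [:[:x:]:]) lambda_shift f"
      by (rule eval_at_natural)
        (simp_all add: additive_const_poly additive_pCons_0 additive_map_poly map_poly_pCons)
    then show ?thesis by (simp add: eval_at_const_variable)
  qed
  have L: "Modules.additive (L a)" by (rule sesquilinear.additive_right[OF assms])
  have "right_triple lambda_shift mu_shift L K a b c = map_poly (L a) (K b c)"
    unfolding right_triple_def product_at_def const using eval_at_pCons_operator[OF L] by simp
  then show ?thesis by (simp add: coeff_map_poly additive.zero[OF L])
qed

lemma (in two_variables) coeff_right_triple_swapped: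
  assumes L: "sesquilinear D L"
  shows "Polynomial.coeff (Polynomial.coeff (right_triple mu_shift lambda_shift L K a b c) j) i
    = Polynomial.coeff (L a (Polynomial.coeff (K b c) i)) j"
proof -
  have const: "product_at mu_shift L a x = map_poly (\<lambda>y. [:y:]) (L a x)" for x
    unfolding product_at_def by (rule eval_at_pCons_operator[OF additive_const_poly])
  have "Polynomial.coeff (Polynomial.coeff (right_triple mu_shift lambda_shift L K a b c) j) i
    = (\<Sum>k\<le>i. if k = i then Polynomial.coeff (L a (Polynomial.coeff (K b c) k)) j else 0)"
    unfolding right_triple_def
    by (subst coeff_eval_at_lambda_shift)
      (auto simp: product_at_additive_right[OF L] commuting_admissible[OF commuting_shifts] const
        coeff_map_poly coeff_pCons simp del: sum.delta intro!: sum.cong split: nat.splits)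
  then show ?thesis by (simp add: sum.delta)
qed

lemma (in two_variables) coeff_left_triple:
  assumes L: "sesquilinear D L" and scl: "Vector_Spaces.vector_space (scl :: 'k::field \<Rightarrow> 'a \<Rightarrow> 'a)"
  shows "Polynomial.coeff (Polynomial.coeff
      (left_triple lambda_shift (\<lambda>v. lambda_shift v + mu_shift v) L K a b c) j) i
    = (\<Sum>k\<le>i. scl (of_nat ((i + j - k) choose j))
        (Polynomial.coeff (L (Polynomial.coeff (K a b) k) c) (i + j - k)))"
proof -
  have adm: "admissible (\<lambda>v. lambda_shift v + mu_shift v)"
    using commuting_admissible[OF commuting_shifts] by (auto intro: admissible_plus)
  have product_at_coeff: "Polynomial.coeff (Polynomial.coeff (product_at (\<lambda>v. lambda_shift v + mu_shift v) L a b) j) i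
    = scl (of_nat ((i + j) choose j)) (Polynomial.coeff (L a b) (i + j))" for a b i j
    unfolding product_at_def by (rule coeff_eval_at_sum_shift[OF scl])
  show ?thesis
    unfolding left_triple_def
    by (subst coeff_eval_at_lambda_shift)
      (auto simp: product_at_additive_left[OF L adm] product_at_coeff
        intro!: sum.cong)
qed

section \<open>Operations given by coefficients\<close>

lemma type_module_simps [simp]:
  "carrier (type_module scl) = UNIV" "\<zero>\<^bsub>type_module scl\<^esub> = 0"
  "x \<oplus>\<^bsub>type_module scl\<^esub> y = x + y" "r \<odot>\<^bsub>type_module scl\<^esub> x = scl r x"
  by (simp_all add: type_module_def)

lemma abelian_group_type_module: "abelian_group (type_module (scl :: 'r \<Rightarrow> 'b \<Rightarrow> 'b::ab_group_add))"
proof (rule abelian_groupI)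
  fix x :: 'b
  show "\<exists>y\<in>carrier (type_module scl). y \<oplus>\<^bsub>type_module scl\<^esub> x = \<zero>\<^bsub>type_module scl\<^esub>"
    by (rule bexI[of _ "- x"]) simp_all
qed (simp_all add: add_ac)

lemma a_inv_type_module [simp]: "\<ominus>\<^bsub>type_module scl\<^esub> x = - x"
  by (rule abelian_group.minus_equality[OF abelian_group_type_module]) simp_all

lemma finsum_type_module [simp]:
  assumes "finite A"
  shows "finsum (type_module scl) f A = sum f A"
  using assms
proof (induction A)
  case empty
  show ?case
    using abelian_monoid.finsum_empty[OF abelian_group.axioms(1)[OF abelian_group_type_module]] by simp
next
  case (insert x A)
  then show ?case
    using abelian_monoid.finsum_insert[OF abelian_group.axioms(1)[OF abelian_group_type_module],
        of A x f scl] by simp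
qed

lemma add_pow_type_module_nat:
  assumes "Vector_Spaces.vector_space scl"
  shows "[n] \<cdot>\<^bsub>type_module scl\<^esub> x = scl (of_nat (n::nat)) x"
proof -
  interpret V: Vector_Spaces.vector_space scl by fact
  show ?thesis
    by (induction n) (simp_all add: add_pow_def V.scale_left_distrib add.commute)
qed

lemma add_pow_type_module_int:
  assumes "Vector_Spaces.vector_space scl"
  shows "[n] \<cdot>\<^bsub>type_module scl\<^esub> x = scl (of_int (n::int)) x"
proof -
  interpret V: Vector_Spaces.vector_space scl by fact
  show ?thesis
    by (cases "n < 0")
      (simp_all add: add_pow_int_ge add_pow_int_lt add_pow_type_module_nat[OF assms] of_nat_nat)
qed

lemma subst_lambda_plus_mu_type_module:
  assumes "Vector_Spaces.vector_space scl"
  shows "subst_lambda_plus_mu (type_module scl) F i j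
    = (\<Sum>k\<le>i. scl (of_nat ((i + j - k) choose j)) (F k (i + j - k)))"
  by (simp add: subst_lambda_plus_mu_def add_pow_type_module_nat[OF assms])

text \<open>
  The value is meaningful only for finitely many nonzero coefficients; otherwise \<^const>\<open>Abs_poly\<close> is
  applied outside its domain.
\<close>

definition op_poly :: "'a lambda_op \<Rightarrow> 'a \<Rightarrow> 'a \<Rightarrow> 'a::zero poly" where
  "op_poly p a b = Abs_poly (p a b)"

lemma coeff_op_poly:
  assumes "polynomial_lambda_op (type_module scl) p"
  shows "Polynomial.coeff (op_poly p a b) = p a b"
proof -
  have "p a b \<in> up (type_module scl)" using assms by (simp add: polynomial_lambda_op_def)
  then obtain n where "bound 0 n (p a b)" by (auto simp: up_def)
  then have "\<forall>m>n. p a b m = 0" by (auto dest: bound.bound)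
  then show ?thesis
    unfolding op_poly_def by (intro Abs_poly_inverse) (auto simp: MOST_nat)
qed

lemma polynomial_lambda_op_coeff:
  "polynomial_lambda_op (type_module scl) (\<lambda>a b. Polynomial.coeff (L a b))"
  unfolding polynomial_lambda_op_def up_def
proof (simp, intro allI)
  fix a b
  show "\<exists>n. bound 0 n (Polynomial.coeff (L a b))"
    by (rule exI[of _ "Polynomial.degree (L a b)"], rule bound.intro) (rule coeff_eq_0)
qed

text \<open>
  Any bound \<open>N\<close> on the degree may be used, so that the induction can strip off the constant term;
  the step is Pascal's rule.
\<close>

lemma coeff_reflect:
  assumes scl: "Vector_Spaces.vector_space scl" and D: "Modules.additive D"
    and D_scl: "\<And>r x. D (scl r x) = scl r (D x)"
    and N: "\<And>m. N \<le> m \<Longrightarrow> Polynomial.coeff f m = 0"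
  shows "Polynomial.coeff (reflect D f) i
    = (\<Sum>m<N. scl (of_int ((- 1) ^ m * int (m choose i))) ((D ^^ (m - i)) (Polynomial.coeff f m)))"
  using N
proof (induction f arbitrary: i N)
  interpret V: Vector_Spaces.vector_space scl by fact
  case 0
  have "(D ^^ k) 0 = 0" for k by (induction k) (simp_all add: additive.zero[OF D])
  then show ?case by (simp add: reflect_def)
next
  interpret V: Vector_Spaces.vector_space scl by fact
  case (pCons a f)
  show ?case
  proof (cases N)
    case 0
    have "Polynomial.coeff (pCons a f) m = 0" for m using pCons.prems[of m] 0 by simp
    then have "pCons a f = 0" by (intro poly_eqI) simp
    then show ?thesis using pCons.hyps by simp
  next
    case (Suc N')
    have prem: "Polynomial.coeff f m = 0" if "N' \<le> m" for m
      using pCons.prems[of "Suc m"] Suc that by simp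
    note IH = pCons.IH[OF prem]
    have E: "Polynomial.coeff (reflect D (pCons a f)) i
      = Polynomial.coeff [:a:] i - Polynomial.coeff (pCons 0 (reflect D f)) i
        - D (Polynomial.coeff (reflect D f) i)"
      unfolding reflect_def
      by (simp add: eval_at_pCons[OF additive_const_poly additive_reflection_operator[OF D]]
          coeff_map_poly additive.zero[OF D] del: minus_pCons)
    show ?thesis
    proof (cases i)
      case 0
      show ?thesis
        unfolding 0 E[unfolded 0] Suc sum.lessThan_Suc_shift
        by (simp add: IH additive.sum[OF D] D_scl V.scale_minus_left sum_negf)
    next
      case (Suc i')
      have step: "scl ((- 1) ^ m * of_nat (m choose Suc i')) (D ((D ^^ (m - Suc i')) x))
        = scl ((- 1) ^ m * of_nat (m choose Suc i')) ((D ^^ (m - i')) x)" for m x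
      proof (cases "Suc i' \<le> m")
        case True
        then have "m - i' = Suc (m - Suc i')" by simp
        then show ?thesis by simp
      next
        case False
        then have "m < Suc i'" by simp
        then show ?thesis by (simp only: binomial_eq_0) simp
      qed
      show ?thesis
        unfolding Suc E[unfolded Suc] \<open>N = Suc N'\<close> sum.lessThan_Suc_shift
        by (simp add: IH additive.sum[OF D] D_scl step V.scale_minus_left
            V.scale_left_distrib V.scale_left_diff_distrib sum_negf sum.distrib sum_subtractf algebra_simps)
    qed
  qed
qed

lemma coeff_opposite:
  assumes scl: "Vector_Spaces.vector_space scl" and D: "Modules.additive D"
    and D_scl: "\<And>r x. D (scl r x) = scl r (D x)"
    and L: "\<And>a b. Polynomial.coeff (L a b) = p a b"
  shows "Polynomial.coeff (opposite D L a b) i = lambda_swap (type_module scl) D p a b i"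
proof -
  interpret V: Vector_Spaces.vector_space scl by fact
  have D0: "(D ^^ k) 0 = 0" for k by (induction k) (simp_all add: additive.zero[OF D])
  let ?N = "Suc (Polynomial.degree (L b a))"
  let ?I = "{m. i \<le> m \<and> p b a m \<noteq> 0}"
  have sub: "?I \<subseteq> {..<?N}"
    using le_degree[of "L b a"] by (auto simp: L less_Suc_eq_le)
  then have fin: "finite ?I" by (rule finite_subset) simp
  have "Polynomial.coeff (opposite D L a b) i
    = (\<Sum>m<?N. scl (of_int ((- 1) ^ m * int (m choose i))) ((D ^^ (m - i)) (p b a m)))"
    unfolding opposite_def
    by (subst coeff_reflect[OF scl D D_scl, of ?N]) (simp_all add: L, simp add: coeff_eq_0 flip: L)
  also have "\<dots> = (\<Sum>m\<in>?I. scl (of_int ((- 1) ^ m * int (m choose i))) ((D ^^ (m - i)) (p b a m)))"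
    using sub by (intro sum.mono_neutral_right) (auto simp: D0, metis binomial_eq_0 not_le_imp_less of_nat_0)
  also have "\<dots> = lambda_swap (type_module scl) D p a b i"
    using fin by (simp add: lambda_swap_def add_pow_type_module_int[OF scl])
  finally show ?thesis .
qed

section \<open>The quotients of an \<open>\<hbar>\<close>-adic associative conformal algebra\<close>

context hbar_adic_assoc_conformal_algebra
begin

sublocale V: Vector_Spaces.vector_space scl by (rule vector_space)

text \<open>
  The coset of \<open>x\<close> modulo \<open>\<hbar>\<^sup>n A[[\<hbar>]]\<close>, described by coefficients so that equality of cosets becomes
  equality of the first \<open>n\<close> coefficients.
\<close>

definition coset :: "nat \<Rightarrow> 'a fps \<Rightarrow> 'a fps set" where
  "coset n x = {y. \<forall>i<n. fps_nth y i = fps_nth x i}"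

lemma fps_scale_X_power:
  "fps_nth (fps_scale scl (fps_X ^ n) x) m = (if n \<le> m then fps_nth x (m - n) else 0)"
proof -
  have "fps_nth (fps_scale scl (fps_X ^ n) x) m = (\<Sum>i\<le>m. if i = n then fps_nth x (m - i) else 0)"
    unfolding fps_scale_def fps_nth_Abs_fps
    by (rule sum.cong) (simp_all add: fps_X_power_nth)
  then show ?thesis by simp
qed

lemma hbar_power_submodule_eq: "hbar_power_submodule scl n = coset n 0"
proof (intro Set.set_eqI iffI)
  fix y assume "y \<in> coset n 0"
  then have "y = fps_scale scl (fps_X ^ n) (Abs_fps (\<lambda>m. fps_nth y (m + n)))"
    by (intro fps_ext) (auto simp: fps_scale_X_power coset_def)
  then show "y \<in> hbar_power_submodule scl n" unfolding hbar_power_submodule_def by blast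
qed (auto simp: hbar_power_submodule_def coset_def fps_scale_X_power)

lemma coset_eq_iff: "coset n x = coset n y \<longleftrightarrow> (\<forall>i<n. fps_nth x i = fps_nth y i)"
  by (auto simp: coset_def)

lemma coset_refl: "x \<in> coset n x"
  by (simp add: coset_def)

lemma r_coset_eq: "hbar_power_submodule scl n +>\<^bsub>hbar_module scl\<^esub> x = coset n x"
proof -
  have "y \<in> (\<Union>h\<in>coset n 0. {h + x}) \<longleftrightarrow> y \<in> coset n x" for y
  proof
    assume "y \<in> coset n x"
    then have "y - x \<in> coset n 0" by (simp add: coset_def)
    then show "y \<in> (\<Union>h\<in>coset n 0. {h + x})" by (rule UN_I) simp
  qed (auto simp: coset_def)
  then show ?thesis
    unfolding hbar_power_submodule_eq a_r_coset_def' hbar_module_def type_module_simps by blast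
qed

abbreviation Q where "Q n \<equiv> quotient_module (hbar_module scl) (hbar_power_submodule scl n)"

lemma carrier_Q: "carrier (Q n) = range (coset n)"
  by (auto simp: quotient_module_def A_RCOSETS_def' r_coset_eq) (auto simp: hbar_module_def)

lemma zero_Q: "\<zero>\<^bsub>Q n\<^esub> = coset n 0"
  by (simp add: quotient_module_def hbar_power_submodule_eq)

lemma coset_add: "coset n x \<oplus>\<^bsub>Q n\<^esub> coset n y = coset n (x + y)"
proof -
  have "z \<in> (\<Union>u\<in>coset n x. \<Union>v\<in>coset n y. {u + v}) \<longleftrightarrow> z \<in> coset n (x + y)" for z
  proof
    assume "z \<in> coset n (x + y)"
    then have "z - x \<in> coset n y" by (simp add: coset_def)
    then show "z \<in> (\<Union>u\<in>coset n x. \<Union>v\<in>coset n y. {u + v})"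
      by (intro UN_I[OF coset_refl] UN_I[of "z - x"]) simp_all
  qed (auto simp: coset_def)
  then have "(\<Union>u\<in>coset n x. \<Union>v\<in>coset n y. {u + v}) = coset n (x + y)" by blast
  then show ?thesis
    by (simp add: quotient_module_def set_add_def' hbar_module_def)
qed

interpretation Q: assoc_conformal_algebra complex_fps_ring "Q n"
    "quotient_map (hbar_module scl) (hbar_power_submodule scl n) Dh"
    "quotient_lambda_op (hbar_module scl) (hbar_power_submodule scl n) ph" for n
  by (rule quotient)

lemma abelian_group_Q: "abelian_group (Q n)"
  by (rule Q.abelian_group_axioms)

lemma coset_uminus: "\<ominus>\<^bsub>Q n\<^esub> coset n x = coset n (- x)"
  by (rule abelian_group.minus_equality[OF abelian_group_Q])
    (auto simp: coset_add zero_Q carrier_Q)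

lemma coset_sum: "finite A \<Longrightarrow> (\<Oplus>\<^bsub>Q n\<^esub>k\<in>A. coset n (f k)) = coset n (sum f A)"
proof (induction A rule: finite_induct)
  case empty
  show ?case
    using abelian_monoid.finsum_empty[OF abelian_group.axioms(1)[OF abelian_group_Q]]
    by (simp add: zero_Q)
next
  case (insert x A)
  then show ?case
    using abelian_monoid.finsum_insert[OF abelian_group.axioms(1)[OF abelian_group_Q],
        of A x "\<lambda>k. coset n (f k)" n]
    by (simp add: coset_add carrier_Q)
qed

lemma coset_multiple:
  "[(m::nat)] \<cdot>\<^bsub>Q n\<^esub> coset n x = coset n (Abs_fps (\<lambda>k. scl (of_nat m) (fps_nth x k)))"
proof (induction m)
  case 0
  then show ?case by (simp add: add_pow_def zero_Q coset_eq_iff)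
next
  case (Suc m)
  have "[Suc m] \<cdot>\<^bsub>Q n\<^esub> coset n x = [m] \<cdot>\<^bsub>Q n\<^esub> coset n x \<oplus>\<^bsub>Q n\<^esub> coset n x"
    by (simp add: add_pow_def)
  then show ?case
    by (simp add: Suc coset_add coset_eq_iff V.scale_left_distrib add.commute)
qed

text \<open>
  An induced map is defined as a union of cosets over all representatives.  Since the axioms of the
  quotient force this union to be a single coset, it is the coset of the value at any representative.
\<close>

lemma coset_Dh: "quotient_map (hbar_module scl) (hbar_power_submodule scl n) Dh (coset n x) = coset n (Dh x)"
proof -
  have "quotient_map (hbar_module scl) (hbar_power_submodule scl n) Dh (coset n x) \<in> range (coset n)"
    using Q.D_closed[of "coset n x" n] by (simp add: carrier_Q)
  then obtain z where z: "quotient_map (hbar_module scl) (hbar_power_submodule scl n) Dh (coset n x) = coset n z"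
    by blast
  have "coset n (Dh x) \<subseteq> coset n z"
    unfolding z[symmetric] quotient_map_def r_coset_eq using coset_refl by blast
  then have "coset n z = coset n (Dh x)"
    using coset_refl[of "Dh x" n] by (auto simp: coset_def)
  then show ?thesis using z by simp
qed

lemma coset_ph:
  "quotient_lambda_op (hbar_module scl) (hbar_power_submodule scl n) ph (coset n x) (coset n y) i
    = coset n (ph x y i)" (is "?q = _")
proof -
  have "?q \<in> range (coset n)"
    using Q.bilinear[of n] by (auto simp: carrier_Q bilinear_lambda_op_def)
  then obtain z where z: "?q = coset n z"
    by blast
  have "coset n (ph x y i) \<subseteq> coset n z"
    unfolding z[symmetric] quotient_lambda_op_def r_coset_eq using coset_refl by blast
  then have "coset n z = coset n (ph x y i)"
    using coset_refl[of "ph x y i" n] by (auto simp: coset_def)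
  then show ?thesis using z by simp
qed

lemma eq_if_all_cosets: "(\<And>n. coset n x = coset n y) \<Longrightarrow> x = y"
  by (rule fps_ext) (metis coset_eq_iff lessI)

text \<open>
  Identities holding modulo every power of \<open>\<hbar>\<close> hold exactly.  This applies to associativity as well,
  because each coefficient of \<open>\<lambda>\<^sup>i \<mu>\<^sup>j\<close> involves only finitely many products.
\<close>

lemma ph_Dh_left: "ph (Dh x) y i = (case i of 0 \<Rightarrow> 0 | Suc k \<Rightarrow> - ph x y k)"
proof (rule eq_if_all_cosets)
  fix n
  show "coset n (ph (Dh x) y i) = coset n (case i of 0 \<Rightarrow> 0 | Suc k \<Rightarrow> - ph x y k)"
    using Q.sesquilinear_left[of "coset n x" n "coset n y" i]
    by (auto simp: carrier_Q coset_ph coset_Dh coset_uminus zero_Q split: nat.splits)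
qed

lemma ph_Dh_right: "ph x (Dh y) i = Dh (ph x y i) + (case i of 0 \<Rightarrow> 0 | Suc k \<Rightarrow> ph x y k)"
proof (rule eq_if_all_cosets)
  fix n
  show "coset n (ph x (Dh y) i) = coset n (Dh (ph x y i) + (case i of 0 \<Rightarrow> 0 | Suc k \<Rightarrow> ph x y k))"
    using Q.sesquilinear_right[of "coset n x" n "coset n y" i]
    by (auto simp: carrier_Q coset_ph coset_Dh coset_add zero_Q split: nat.splits)
qed

lemma ph_associative:
  "fps_nth (ph x (ph y z j) i) N
    = (\<Sum>k\<le>i. scl (of_nat ((i + j - k) choose j)) (fps_nth (ph (ph x y k) z (i + j - k)) N))"
proof -
  let ?n = "Suc N"
  have "coset ?n (ph x (ph y z j) i) = coset ?n (\<Sum>k\<le>i. Abs_fps (\<lambda>m.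
      scl (of_nat ((i + j - k) choose j)) (fps_nth (ph (ph x y k) z (i + j - k)) m)))"
    using Q.associative[of "coset ?n x" ?n "coset ?n y" "coset ?n z" j i]
    by (simp add: carrier_Q coset_ph subst_lambda_plus_mu_def coset_multiple coset_sum)
  then show ?thesis by (simp add: coset_eq_iff fps_sum_nth)
qed

end

section \<open>The semi-classical limit\<close>

context conformal_deformation
begin

lemma D_additive: "Modules.additive D"
  using D_add by unfold_locales simp

lemma D_scl: "D (scl r x) = scl r (D x)"
  using D_smult[of r x] by (simp add: ring_of_type_algebra_def)

lemma ph_add_left: "ph (x + x') y i = ph x y i + ph x' y i"
  and ph_add_right: "ph x (y + y') i = ph x y i + ph x y' i"
  and ph_scale_left: "ph (fps_scale scl r x) y i = fps_scale scl r (ph x y i)"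
  and ph_scale_right: "ph x (fps_scale scl r y) i = fps_scale scl r (ph x y i)"
  using deformed.bilinear
  by (simp_all add: bilinear_lambda_op_def hbar_module_def ring_of_type_algebra_def)

lemma fps_decompose: "x = fps_const (fps_nth x 0) + fps_scale scl (fps_X ^ 1) (fps_shift 1 x)"
proof (rule fps_ext)
  fix n
  show "fps_nth x n = fps_nth (fps_const (fps_nth x 0) + fps_scale scl (fps_X ^ 1) (fps_shift 1 x)) n"
    unfolding fps_add_nth deformed.fps_scale_X_power by (cases n) simp_all
qed

text \<open>
  Splitting off the constant term \<open>x\<^sub>0\<close> of \<open>x\<close> and using \<open>\<hbar>\<close>-linearity on the rest gives each coefficient of
  the deformed product by induction on the power of \<open>\<hbar>\<close>.
\<close>

lemma ph_const_left:
  "fps_nth (ph (fps_const a) x i) N = (\<Sum>m\<le>N. \<mu> m a (fps_nth x (N - m)) i)"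
proof (induction N arbitrary: x)
  case 0
  show ?case
    by (subst fps_decompose)
      (simp only: ph_add_right ph_scale_right fps_add_nth deformed.fps_scale_X_power, simp add: expansion)
next
  case (Suc N)
  have "fps_nth (ph (fps_const a) x i) (Suc N)
      = \<mu> (Suc N) a (fps_nth x 0) i + fps_nth (ph (fps_const a) (fps_shift 1 x) i) N"
    by (subst fps_decompose)
      (simp only: ph_add_right ph_scale_right fps_add_nth deformed.fps_scale_X_power, simp add: expansion)
  then show ?case by (simp add: Suc Suc_diff_le add.commute)
qed

lemma ph_const_right:
  "fps_nth (ph x (fps_const b) i) N = (\<Sum>m\<le>N. \<mu> m (fps_nth x (N - m)) b i)"
proof (induction N arbitrary: x)
  case 0
  show ?case
    by (subst fps_decompose)
      (simp only: ph_add_left ph_scale_left fps_add_nth deformed.fps_scale_X_power, simp add: expansion)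
next
  case (Suc N)
  have "fps_nth (ph x (fps_const b) i) (Suc N)
      = \<mu> (Suc N) (fps_nth x 0) b i + fps_nth (ph (fps_shift 1 x) (fps_const b) i) N"
    by (subst fps_decompose)
      (simp only: ph_add_left ph_scale_left fps_add_nth deformed.fps_scale_X_power, simp add: expansion)
  then show ?case by (simp add: Suc Suc_diff_le add.commute)
qed

text \<open>The coefficient of \<open>\<hbar>\<^sup>N\<close> in associativity for three elements of \<open>A\<close>.\<close>

lemma \<mu>_associative:
  "(\<Sum>m\<le>N. \<mu> m a (\<mu> (N - m) b c j) i)
    = (\<Sum>k\<le>i. scl (of_nat ((i + j - k) choose j))
        (\<Sum>m\<le>N. \<mu> m (\<mu> (N - m) a b k) c (i + j - k)))"
  using deformed.ph_associative[of "fps_const a" "fps_const b" "fps_const c" j i N]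
  by (simp add: ph_const_left ph_const_right expansion)

lemma fps_map_nth: "fps_nth (fps_map D x) n = D (fps_nth x n)"
  by (simp add: fps_map_def)

lemma fps_map_const: "fps_map D (fps_const a) = fps_const (D a)"
  by (rule fps_ext) (simp add: fps_map_def additive.zero[OF D_additive])

lemma \<mu>_D_left: "\<mu> n (D a) b i = (case i of 0 \<Rightarrow> 0 | Suc k \<Rightarrow> - \<mu> n a b k)"
  using arg_cong[OF deformed.ph_Dh_left[of "fps_const a" "fps_const b" i], of "\<lambda>x. fps_nth x n"]
  by (simp add: fps_map_const expansion split: nat.splits)

lemma \<mu>_D_right: "\<mu> n a (D b) i = D (\<mu> n a b i) + (case i of 0 \<Rightarrow> 0 | Suc k \<Rightarrow> \<mu> n a b k)"
  using arg_cong[OF deformed.ph_Dh_right[of "fps_const a" "fps_const b" i], of "\<lambda>x. fps_nth x n"]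
  by (simp add: fps_map_const expansion fps_map_nth split: nat.splits)

abbreviation \<mu>poly where "\<mu>poly n \<equiv> op_poly (\<mu> n)"

lemma coeff_\<mu>: "Polynomial.coeff (\<mu>poly n a b) = \<mu> n a b"
  by (rule coeff_op_poly[OF \<mu>_polynomial])

lemma \<mu>_add: "\<mu> n (a + a') b i = \<mu> n a b i + \<mu> n a' b i"
    "\<mu> n a (b + b') i = \<mu> n a b i + \<mu> n a b' i"
  and \<mu>_scl: "\<mu> n (scl r a) b i = scl r (\<mu> n a b i)" "\<mu> n a (scl r b) i = scl r (\<mu> n a b i)"
  using \<mu>_bilinear[of n] by (simp_all add: bilinear_lambda_op_def ring_of_type_algebra_def)

lemma sesquilinear_\<mu>: "sesquilinear D (\<mu>poly n)"
  by unfold_locales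
    (auto intro!: poly_eqI simp: coeff_\<mu> \<mu>_add \<mu>_D_left \<mu>_D_right coeff_map_poly
      additive.zero[OF D_additive] coeff_pCons split: nat.splits)

sublocale W: two_variables D by (rule two_variables.intro) (rule D_additive)

lemma scl: "Vector_Spaces.vector_space scl" by (rule deformed.vector_space)

lemma \<mu>poly_associative:
  assumes "W.commuting S T"
  shows "(\<Sum>m\<le>N. W.right_triple S T (\<mu>poly m) (\<mu>poly (N - m)) a b c)
    = (\<Sum>m\<le>N. W.left_triple S (\<lambda>v. S v + T v) (\<mu>poly m) (\<mu>poly (N - m)) a b c)"
proof (rule W.associative_transfer[OF sesquilinear_\<mu> _ assms])
  fix a b c
  show "(\<Sum>m\<le>N. W.right_triple lambda_shift mu_shift (\<mu>poly m) (\<mu>poly (N - m)) a b c)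
    = (\<Sum>m\<le>N. W.left_triple lambda_shift (\<lambda>v. lambda_shift v + mu_shift v) (\<mu>poly m) (\<mu>poly (N - m)) a b c)"
  proof (intro poly_eqI)
    fix i j
    have "(\<Sum>m\<le>N. \<mu> m a (\<mu> (N - m) b c j) i) = (\<Sum>m\<le>N. \<Sum>k\<le>i. scl (of_nat ((i + j - k) choose j))
        (\<mu> m (\<mu> (N - m) a b k) c (i + j - k)))"
      unfolding \<mu>_associative deformed.V.scale_sum_right by (rule sum.swap)
    then show "Polynomial.coeff (Polynomial.coeff (\<Sum>m\<le>N. W.right_triple lambda_shift mu_shift (\<mu>poly m) (\<mu>poly (N - m)) a b c) j) i
      = Polynomial.coeff (Polynomial.coeff (\<Sum>m\<le>N. W.left_triple lambda_shift (\<lambda>v. lambda_shift v + mu_shift v) (\<mu>poly m) (\<mu>poly (N - m)) a b c) j) i"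
      by (simp add: coeff_sum W.coeff_right_triple[OF sesquilinear_\<mu>]
          W.coeff_left_triple[OF sesquilinear_\<mu> scl] coeff_\<mu>)
  qed
qed

definition bracket where "bracket = commutator D (\<mu>poly 1)"

lemma coeff_bracket: "Polynomial.coeff (bracket a b) i = semiclassical_bracket scl D \<mu> a b i"
  by (simp add: bracket_def commutator_def semiclassical_bracket_def coeff_\<mu>
      coeff_opposite[OF scl D_additive D_scl coeff_\<mu>])

lemma sesquilinear_bracket: "sesquilinear D bracket"
  unfolding bracket_def by (rule commutator_sesquilinear[OF D_additive sesquilinear_\<mu>])

lemma commutator_\<mu>_0: "commutator D (\<mu>poly 0) = (\<lambda>_ _. 0)"
proof (intro ext poly_eqI)
  fix a b i
  show "Polynomial.coeff (commutator D (\<mu>poly 0) a b) i = Polynomial.coeff 0 i"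
    using commutative[of a b i]
    by (simp add: commutator_def coeff_\<mu> coeff_opposite[OF scl D_additive D_scl coeff_\<mu>] flip: \<mu>_0)
qed

text \<open>
  For \<open>N = 2\<close> the summands of the Jacobi identity are the pairs \<open>(\<mu>\<^sub>0, \<mu>\<^sub>2)\<close>, \<open>(\<mu>\<^sub>1, \<mu>\<^sub>1)\<close>, \<open>(\<mu>\<^sub>2, \<mu>\<^sub>0)\<close>; the outer two
  vanish with the commutator of \<open>\<mu>\<^sub>0\<close>.
\<close>

lemma bracket_Jacobi:
  assumes "W.commuting S T"
  shows "W.right_triple S T bracket bracket a b c
    = W.left_triple S (\<lambda>v. S v + T v) bracket bracket a b c + W.right_triple T S bracket bracket b a c"
proof -
  have SST: "W.commuting S (\<lambda>v. S v + T v)"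
    using W.commuting_admissible[OF assms] W.commuting_simps[OF assms]
    by (auto simp: W.commuting_def intro!: W.admissible_intros)
  have s: "{..2::nat} = {0, 1, 2}" by auto
  show ?thesis
    using W.commutator_Jacobi[of "{..2}" \<mu>poly "\<lambda>m. \<mu>poly (2 - m)", OF sesquilinear_\<mu>
        \<mu>poly_associative assms, of a b c]
    by (simp add: s commutator_\<mu>_0 W.triple_zero[OF assms] W.triple_zero[OF SST]
        W.triple_zero[OF W.commuting_sym[OF assms]] bracket_def)
qed

text \<open>
  For \<open>N = 1\<close> the left-hand side of the Leibniz rule takes the commutator of the outer operation and
  keeps the pair \<open>(\<mu>\<^sub>1, \<mu>\<^sub>0)\<close>; the right-hand side takes the commutator of the inner one and keeps \<open>(\<mu>\<^sub>0, \<mu>\<^sub>1)\<close>.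
\<close>

lemma bracket_Leibniz:
  assumes "W.commuting S T"
  shows "W.right_triple S T bracket (\<mu>poly 0) a b c
    = W.left_triple S (\<lambda>v. S v + T v) (\<mu>poly 0) bracket a b c + W.right_triple T S (\<mu>poly 0) bracket b a c"
proof -
  have SST: "W.commuting S (\<lambda>v. S v + T v)"
    using W.commuting_admissible[OF assms] W.commuting_simps[OF assms]
    by (auto simp: W.commuting_def intro!: W.admissible_intros)
  have s: "{..1::nat} = {0, 1}" by auto
  show ?thesis
    using W.commutator_Leibniz[of "{..1}" \<mu>poly "\<lambda>m. \<mu>poly (1 - m)", OF sesquilinear_\<mu>
        \<mu>poly_associative assms, of a b c]
    by (simp add: s commutator_\<mu>_0 W.triple_zero[OF assms] W.triple_zero[OF SST]
        W.triple_zero[OF W.commuting_sym[OF assms]] bracket_def)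
qed

lemmas triple_coeffs = W.coeff_right_triple W.coeff_right_triple_swapped W.coeff_left_triple[OF _ scl]

lemma bracket_scl:
  "Polynomial.coeff (bracket (scl r a) b) i = scl r (Polynomial.coeff (bracket a b) i)"
  "Polynomial.coeff (bracket a (scl r b)) i = scl r (Polynomial.coeff (bracket a b) i)"
proof -
  have h: "Modules.additive (scl r)"
    by unfold_locales (rule deformed.V.scale_right_distrib)
  have \<mu>: "\<mu>poly 1 (scl r a) b = map_poly (scl r) (\<mu>poly 1 a b)"
    "\<mu>poly 1 a (scl r b) = map_poly (scl r) (\<mu>poly 1 a b)" for a b
    by (auto intro!: poly_eqI simp: coeff_\<mu> coeff_map_poly \<mu>_scl)
  have "bracket (scl r a) b = map_poly (scl r) (bracket a b)"
    "bracket a (scl r b) = map_poly (scl r) (bracket a b)"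
    unfolding bracket_def
    by (rule commutator_map_poly[OF D_additive h]; simp add: D_scl \<mu>[simplified])+
  then show "Polynomial.coeff (bracket (scl r a) b) i = scl r (Polynomial.coeff (bracket a b) i)"
    "Polynomial.coeff (bracket a (scl r b)) i = scl r (Polynomial.coeff (bracket a b) i)"
    by (simp_all add: coeff_map_poly)
qed

lemma Poisson_bracket:
  "Poisson_conformal_algebra complex_ring (type_module scl) D p
    (\<lambda>a b. Polynomial.coeff (bracket a b))"
proof (intro Poisson_conformal_algebra.intro Lie_conformal_algebra.intro conformal_algebra.intro)
  interpret B: sesquilinear D bracket by (rule sesquilinear_bracket)
  show "comm_assoc_conformal_algebra complex_ring (type_module scl) D p"
    by (rule comm_assoc_conformal_algebra_axioms)
  show "differential_module complex_ring (type_module scl) D"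
    by (rule differential_module_axioms)
  show "conformal_algebra_axioms complex_ring (type_module scl) D (\<lambda>a b. Polynomial.coeff (bracket a b))"
  proof
    show "bilinear_lambda_op complex_ring (type_module scl) (\<lambda>a b. Polynomial.coeff (bracket a b))"
      by (simp add: bilinear_lambda_op_def B.add_left B.add_right bracket_scl)
    show "polynomial_lambda_op (type_module scl) (\<lambda>a b. Polynomial.coeff (bracket a b))"
      by (rule polynomial_lambda_op_coeff)
  qed (simp_all add: B.D_left B.D_right coeff_pCons coeff_map_poly additive.zero[OF D_additive] split: nat.splits)
  show "Lie_conformal_algebra_axioms (type_module scl) D (\<lambda>a b. Polynomial.coeff (bracket a b))"
  proof
    fix a b i
    have "lambda_swap (type_module scl) D (\<lambda>a b. Polynomial.coeff (bracket a b)) a b i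
        = Polynomial.coeff (opposite D bracket a b) i"
      by (rule coeff_opposite[OF scl D_additive D_scl, symmetric]) (rule refl)
    also have "\<dots> = - Polynomial.coeff (bracket a b) i"
      using opposite_commutator[OF D_additive, of "\<mu>poly 1" a b] by (simp add: bracket_def)
    finally show "Polynomial.coeff (bracket a b) i
      = \<ominus>\<^bsub>type_module scl\<^esub> lambda_swap (type_module scl) D (\<lambda>a b. Polynomial.coeff (bracket a b)) a b i"
      by simp
  next
    fix a b c i j
    show "Polynomial.coeff (bracket a (Polynomial.coeff (bracket b c) j)) i
      = subst_lambda_plus_mu (type_module scl)
          (\<lambda>k m. Polynomial.coeff (bracket (Polynomial.coeff (bracket a b) k) c) m) i j
        \<oplus>\<^bsub>type_module scl\<^esub> Polynomial.coeff (bracket b (Polynomial.coeff (bracket a c) i)) j"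
      using arg_cong[OF bracket_Jacobi[OF W.commuting_shifts, of a b c],
        of "\<lambda>v. Polynomial.coeff (Polynomial.coeff v j) i"]
      by (simp add: triple_coeffs[OF sesquilinear_bracket] subst_lambda_plus_mu_type_module[OF scl])
  qed
  show "Poisson_conformal_algebra_axioms (type_module scl) p (\<lambda>a b. Polynomial.coeff (bracket a b))"
  proof
    fix a b c i j
    show "Polynomial.coeff (bracket a (p b c j)) i
      = subst_lambda_plus_mu (type_module scl)
          (\<lambda>k m. p (Polynomial.coeff (bracket a b) k) c m) i j
        \<oplus>\<^bsub>type_module scl\<^esub> p b (Polynomial.coeff (bracket a c) i) j"
      using arg_cong[OF bracket_Leibniz[OF W.commuting_shifts, of a b c],
        of "\<lambda>v. Polynomial.coeff (Polynomial.coeff v j) i"]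
      by (simp add: triple_coeffs[OF sesquilinear_bracket] triple_coeffs[OF sesquilinear_\<mu>]
          coeff_\<mu> subst_lambda_plus_mu_type_module[OF scl] flip: \<mu>_0)
  qed
qed

end

theorem theorem4p8:
  fixes scl :: "complex \<Rightarrow> 'a::ab_group_add \<Rightarrow> 'a"
    and D :: "'a \<Rightarrow> 'a"
    and p :: "'a lambda_op"
    and ph :: "'a fps lambda_op"
    and \<mu> :: "nat \<Rightarrow> 'a lambda_op"
  assumes "comm_assoc_conformal_algebra complex_ring (type_module scl) D p"
    and "conformal_deformation scl D p ph \<mu>"
  shows "Poisson_conformal_algebra complex_ring (type_module scl) D p
    (semiclassical_bracket scl D \<mu>)"
proof -
  have "(\<lambda>a b. Polynomial.coeff (conformal_deformation.bracket D \<mu> a b)) = semiclassical_bracket scl D \<mu>"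
    by (intro ext) (rule conformal_deformation.coeff_bracket[OF assms(2)])
  then show ?thesis
    using conformal_deformation.Poisson_bracket[OF assms(2)] by simp
qed

end
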